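(* Fix integers $q\ge 2$, $k\ge 3$ and $r$ with $3\le r\le k$, and let $u(n)$ satisfy $u(n)\to\infty$ and $u(n)/n\to 0$. Suppose every local function $f_a\colon[q]^k\to[q]^{k-r+1}$ used in the generator has MDS inverse image of dimension $r-1$. Let $\mu$ be any constant with $\mu>\mu_{\mathrm c}(k,r):=\binom{k}{r}^{-1}\frac{(r-2)^{r-2}}{r(r-1)^{r-1}}$ and let $m=\lfloor \mu\, n^{r-1}/u(n)^{r-2}\rfloor$. Then there are constants $c>0$ and $\beta>0$ such that for all sufficiently large $n$, with probability at least $1-e^{-c\,u(n)}$, every zero-optimal solution of the LP below has an integral part of size at least $\beta n$ (i.e. the LP relaxation fixes linearly many input variables).
   Context: Random generalized Goldreich generator: $[q]=\{1,\dots,q\}$. For each $a\in[m]$ a (deterministic) function $f_a\colon[q]^k\to[q]^{k-r+1}$ is fixed. For each $a\in[m]$ independently, a $k$-tuple $(i^{(a)}_1,\dots,i^{(a)}_k)$ of pairwise distinct elements of $[n]$ is chosen uniformly among all $n(n-1)\cdots(n-k+1)$ such tuples; write $\partial(a)=\{i^{(a)}_1,\dots,i^{(a)}_k\}$ and $\bm x^{(a)}=(x_{i^{(a)}_1},\dots,x_{i^{(a)}_k})$. A planted input $\bm x^*$ is chosen uniformly from $[q]^n$, independently, and $\bm y_a:=f_a(\bm x^{*(a)})$. MDS inverse image of dimension $r-1$: for every $\bm y\in[q]^{k-r+1}$, the set $f^{-1}(\bm y)\subseteq[q]^k$ has exactly $q^{r-1}$ elements and any two distinct elements of it differ in at least $k-r+2$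 coordinates. The LP (local marginal polytope relaxation with the first $u(n)$ variables fixed to planted values): the variables are probability distributions $b_i$ on $[q]$ for $i\in[n]$ and $b_{(a)}$ on $[q]^k$ for $a\in[m]$, subject to (i) for every $a\in[m]$ and every position $s\in[k]$, the marginal of $b_{(a)}$ on its $s$-th coordinate equals $b_{i^{(a)}_s}$; (ii) $b_i(x^*_i)=1$ for $i=1,\dots,u(n)$. The objective to minimize is $\sum_{a=1}^m\sum_{\bm x\in[q]^k} b_{(a)}(\bm x)\,\mathbb I\{f_a(\bm x)\ne\bm y_a\}$. A zero-optimal solution is a feasible point with objective value $0$. The integral part of a feasible point is $\{i\in[n]:\exists x\in[q],\ b_i(x)=1\}$. *)

theory Defs
  imports Complex_Main "HOL-Library.FuncSet"
begin

text \<open>The alphabet [q] is represented as {0..<q}; the variable set [n] as {0..<n};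
  positions [k] as {0..<k}; constraint indices [m] as {0..<m}.
  Vectors of length d are functions nat => nat restricted to {..<d}.\<close>

definition cube :: "nat \<Rightarrow> nat \<Rightarrow> (nat \<Rightarrow> nat) set" where
  "cube q d = PiE {..<d} (\<lambda>_. {..<q})"

text \<open>k-tuples of pairwise distinct elements of [n].\<close>
definition tuples :: "nat \<Rightarrow> nat \<Rightarrow> (nat \<Rightarrow> nat) set" where
  "tuples n k = {t \<in> PiE {..<k} (\<lambda>_. {..<n}). inj_on t {..<k}}"

text \<open>All choices of the m tuples (one for each constraint a).\<close>
definition hypergraphs :: "nat \<Rightarrow> nat \<Rightarrow> nat \<Rightarrow> (nat \<Rightarrow> nat \<Rightarrow> nat) set" where
  "hypergraphs n k m = PiE {..<m} (\<lambda>_. tuples n k)"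

definition agree :: "nat \<Rightarrow> (nat \<Rightarrow> nat) \<Rightarrow> (nat \<Rightarrow> nat) \<Rightarrow> bool" where
  "agree d y z \<longleftrightarrow> (\<forall>j<d. y j = z j)"

text \<open>f : [q]^k -> [q]^(k-r+1) has MDS inverse image of dimension r-1.\<close>
definition mds_inverse_image :: "nat \<Rightarrow> nat \<Rightarrow> nat \<Rightarrow> ((nat \<Rightarrow> nat) \<Rightarrow> (nat \<Rightarrow> nat)) \<Rightarrow> bool" where
  "mds_inverse_image q k r f \<longleftrightarrow>
     (\<forall>x\<in>cube q k. \<forall>j<k-r+1. f x j < q) \<and>
     (\<forall>y\<in>cube q (k-r+1).
        card {x\<in>cube q k. agree (k-r+1) (f x) y} = q ^ (r-1) \<and>
        (\<forall>x\<in>cube q k. \<forall>x'\<in>cube q k.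
            agree (k-r+1) (f x) y \<longrightarrow> agree (k-r+1) (f x') y \<longrightarrow> x \<noteq> x' \<longrightarrow>
            k - r + 2 \<le> card {s\<in>{..<k}. x s \<noteq> x' s}))"

definition is_dist :: "'a set \<Rightarrow> ('a \<Rightarrow> real) \<Rightarrow> bool" where
  "is_dist A p \<longleftrightarrow> (\<forall>x\<in>A. 0 \<le> p x) \<and> sum p A = 1"

text \<open>Planted local input x^{*(a)} for tuple t a.\<close>
definition local_input :: "nat \<Rightarrow> (nat \<Rightarrow> nat) \<Rightarrow> (nat \<Rightarrow> nat) \<Rightarrow> (nat \<Rightarrow> nat)" where
  "local_input k ta xs = restrict (\<lambda>s. xs (ta s)) {..<k}"

text \<open>Feasibility for the local marginal polytope with the first uu variables fixed.
  bi i is the distribution b_i on [q]; ba a is the distribution b_(a) on [q]^k.\<close>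
definition lp_feasible ::
  "nat \<Rightarrow> nat \<Rightarrow> nat \<Rightarrow> nat \<Rightarrow> nat \<Rightarrow> (nat \<Rightarrow> nat \<Rightarrow> nat) \<Rightarrow> (nat \<Rightarrow> nat)
   \<Rightarrow> (nat \<Rightarrow> nat \<Rightarrow> real) \<Rightarrow> (nat \<Rightarrow> (nat \<Rightarrow> nat) \<Rightarrow> real) \<Rightarrow> bool" where
  "lp_feasible q k n m uu t xs bi ba \<longleftrightarrow>
     (\<forall>i<n. is_dist {..<q} (bi i)) \<and>
     (\<forall>a<m. is_dist (cube q k) (ba a)) \<and>
     (\<forall>a<m. \<forall>s<k. \<forall>v<q. sum (ba a) {x\<in>cube q k. x s = v} = bi (t a s) v) \<and>
     (\<forall>i<uu. bi i (xs i) = 1)"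

definition lp_objective ::
  "nat \<Rightarrow> nat \<Rightarrow> nat \<Rightarrow> nat \<Rightarrow> (nat \<Rightarrow> (nat \<Rightarrow> nat) \<Rightarrow> (nat \<Rightarrow> nat))
   \<Rightarrow> (nat \<Rightarrow> nat \<Rightarrow> nat) \<Rightarrow> (nat \<Rightarrow> nat) \<Rightarrow> (nat \<Rightarrow> (nat \<Rightarrow> nat) \<Rightarrow> real) \<Rightarrow> real" where
  "lp_objective q k r m f t xs ba =
     (\<Sum>a<m. \<Sum>x\<in>cube q k.
        ba a x * (if agree (k-r+1) (f a x) (f a (local_input k (t a) xs)) then 0 else 1))"

definition zero_optimal where
  "zero_optimal q k r n m uu f t xs bi ba \<longleftrightarrow>
     lp_feasible q k n m uu t xs bi ba \<and> lp_objective q k r m f t xs ba = 0"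

definition integral_part :: "nat \<Rightarrow> nat \<Rightarrow> (nat \<Rightarrow> nat \<Rightarrow> real) \<Rightarrow> nat set" where
  "integral_part q n bi = {i\<in>{..<n}. \<exists>v<q. bi i v = 1}"

definition mu_crit :: "nat \<Rightarrow> nat \<Rightarrow> real" where
  "mu_crit k r = (1 / real (k choose r)) *
      (real (r-2) ^ (r-2) / (real r * real (r-1) ^ (r-1)))"

definition num_constraints :: "real \<Rightarrow> nat \<Rightarrow> nat \<Rightarrow> nat \<Rightarrow> nat" where
  "num_constraints \<mu> r un n = nat \<lfloor>\<mu> * real n ^ (r-1) / real un ^ (r-2)\<rfloor>"

text \<open>Probability (uniform over hypergraph choices and planted inputs) that every
  zero-optimal LP solution has integral part of size at least beta*n.\<close>
definition prob_good ::
  "nat \<Rightarrow> nat \<Rightarrow> nat \<Rightarrow> nat \<Rightarrow> nat \<Rightarrow> nat \<Rightarrow> (nat \<Rightarrow> (nat \<Rightarrow> nat) \<Rightarrow> (nat \<Rightarrow> nat)) \<Rightarrow> real \<Rightarrow> real" where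
  "prob_good q k r n m uu f \<beta> =
     real (card {(t, xs) \<in> hypergraphs n k m \<times> cube q n.
              \<forall>bi ba. zero_optimal q k r n m uu f t xs bi ba \<longrightarrow>
                       \<beta> * real n \<le> real (card (integral_part q n bi))})
     / real (card (hypergraphs n k m \<times> cube q n))"

end

theory Submission
  imports Defs
begin

text \<open>By the MDS property, once \<open>r - 1\<close> variables of a constraint are fixed to their planted
  values, so are all the others. The integral part therefore contains the closure of the first
  \<open>u\<close> vertices under the rule ``an edge with \<open>r - 1\<close> vertices inside is absorbed'', whatever
  the functions and the planted input are. If this closure is a set \<open>S\<close> of size \<open>s\<close>, then no
  edge meets \<open>S\<close> in \<open>r - 1\<close> or more vertices without lying inside \<open>S\<close>, and the new vertices
  \<open>S - U\<close> can be charged to edges inside \<open>S\<close> so that each edge pays for at most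
  \<open>k - r + 1\<close> of them. A union bound over \<open>S\<close> and over all ways of charging is sharp: weighting
  each new vertex by \<open>exp (- \<theta>)\<close>, as in Chernoff's bound, it shows that size \<open>s\<close> has probability
  at most \<open>exp (- c * s)\<close> for all \<open>s\<close> between \<open>u\<close> and \<open>\<beta> * n\<close>, precisely because above the
  threshold the expected number of vertices produced by a set of size \<open>s\<close> exceeds \<open>s - u\<close>
  by a constant factor.\<close>

section \<open>Peeling and zero-optimal solutions\<close>

definition peel_closed :: "nat \<Rightarrow> nat \<Rightarrow> (nat \<Rightarrow> 'a set) \<Rightarrow> 'a set \<Rightarrow> bool" where
  "peel_closed r m E A \<longleftrightarrow> (\<forall>a<m. r \<le> card (E a \<inter> A) \<longrightarrow> E a \<subseteq> A)"

text \<open>The intersection form avoids fixing an order in which edges are absorbed. The family is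
  never empty, since \<open>UNIV\<close> is closed. The threshold, here called \<open>r\<close>, is
  \<open>r - 1\<close> in the application to the LP.\<close>

definition peel_closure :: "nat \<Rightarrow> nat \<Rightarrow> (nat \<Rightarrow> 'a set) \<Rightarrow> 'a set \<Rightarrow> 'a set" where
  "peel_closure r m E U = \<Inter>{A. U \<subseteq> A \<and> peel_closed r m E A}"

lemma subset_peel_closure: "U \<subseteq> peel_closure r m E U"
  by (auto simp: peel_closure_def)

lemma peel_closure_least:
  assumes "U \<subseteq> A" "peel_closed r m E A"
  shows "peel_closure r m E U \<subseteq> A"
  using assms by (auto simp: peel_closure_def)

text \<open>An edge meets any closed superset of \<open>U\<close> in at least as many vertices as it
  meets the closure, so the threshold is inherited by every member of the intersection. Finiteness
  of the edges makes \<open>card\<close> monotone here.\<close>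

lemma peel_closed_closure:
  assumes "\<And>a. a < m \<Longrightarrow> finite (E a)"
  shows "peel_closed r m E (peel_closure r m E U)"
  unfolding peel_closed_def
proof (intro allI impI)
  fix a assume a: "a < m" and le: "r \<le> card (E a \<inter> peel_closure r m E U)"
  have "E a \<subseteq> A" if A: "U \<subseteq> A" "peel_closed r m E A" for A
  proof -
    have "card (E a \<inter> peel_closure r m E U) \<le> card (E a \<inter> A)"
      using peel_closure_least[OF A] assms[OF a] by (intro card_mono) auto
    then show ?thesis using le a A by (auto simp: peel_closed_def)
  qed
  then show "E a \<subseteq> peel_closure r m E U" by (auto simp: peel_closure_def)
qed

text \<open>An edge absorbed when \<open>r\<close> of its \<open>k\<close> vertices are already
  present brings at most \<open>k - r\<close> new ones and can pay for exactly these. Instead of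
  running the absorption step by step, the proof takes a largest set that admits such a charging and
  shows that it is closed.\<close>

lemma peel_closure_witness:
  assumes fin: "\<And>a. a < m \<Longrightarrow> finite (E a)" and card: "\<And>a. a < m \<Longrightarrow> card (E a) = k"
    and finS: "finite S" and S: "peel_closure r m E U = S"
  shows "\<exists>F. S - U \<subseteq> (\<Union>a<m. F a) \<and>
           (\<forall>a<m. F a \<noteq> {} \<longrightarrow> F a \<subseteq> E a \<and> E a \<subseteq> S \<and> card (F a) \<le> k - r)"
proof -
  \<comment> \<open>\<open>A\<close> is an intermediate stage between \<open>U\<close> and
    \<open>S\<close>, and \<open>F\<close> charges the vertices gained so far to edges that already
    lie inside \<open>A\<close>.\<close>
  define Q where "Q A F \<longleftrightarrow> U \<subseteq> A \<and> A \<subseteq> S \<and> A - U \<subseteq> (\<Union>a<m. F a) \<and>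
       (\<forall>a<m. F a \<noteq> {} \<longrightarrow> F a \<subseteq> E a \<and> E a \<subseteq> A \<and> card (F a) \<le> k - r)" for A F
  have closed: "peel_closed r m E S"
    using peel_closed_closure[of m E r U] fin S by simp
  have "U \<subseteq> S" using subset_peel_closure[of U r m E] by (simp add: S)
  then have "Q U (\<lambda>_. {})" by (auto simp: Q_def)
  then have QU: "\<exists>F. Q U F" by (rule exI[of _ "\<lambda>_. {}"])
  have "\<forall>A. (\<exists>F. Q A F) \<longrightarrow> card A < Suc (card S)"
    using finS by (auto simp: Q_def less_Suc_eq_le intro: card_mono)
  then have "\<exists>A. (\<exists>F. Q A F) \<and> (\<forall>A'. (\<exists>F. Q A' F) \<longrightarrow> card A' \<le> card A)"
    by (rule ex_has_greatest_nat[where P = "\<lambda>A. \<exists>F. Q A F" and f = card, OF QU])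
  then obtain A where A: "\<exists>F. Q A F" and max: "\<And>A'. \<exists>F. Q A' F \<Longrightarrow> card A' \<le> card A"
    by blast
  obtain F where F: "Q A F" using A by blast
  have finA: "finite A" using F finS finite_subset by (auto simp: Q_def)
  have "peel_closed r m E A"
    unfolding peel_closed_def
  proof (intro allI impI, rule ccontr)
    fix a assume a: "a < m" and le: "r \<le> card (E a \<inter> A)" and nsub: "\<not> E a \<subseteq> A"
    have ES: "E a \<subseteq> S"
    proof -
      have "card (E a \<inter> A) \<le> card (E a \<inter> S)"
        using F fin[OF a] by (intro card_mono) (auto simp: Q_def)
      then show ?thesis using closed le a by (auto simp: peel_closed_def)
    qed
    \<comment> \<open>A paying edge lies inside \<open>A\<close>, but edge \<open>a\<close> does
      not. Redefining \<open>F\<close> at \<open>a\<close> therefore loses no earlier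
      charge.\<close>
    have Fa: "F a = {}" using F a nsub by (auto simp: Q_def)
    have "card (E a - A) = card (E a) - card (E a \<inter> A)"
      using fin[OF a] by (simp add: card_Diff_subset_Int)
    then have le2: "card (E a - A) \<le> k - r" using card[OF a] le by simp
    let ?F = "F(a := E a - A)"
    have "A \<union> E a - U \<subseteq> (\<Union>a<m. ?F a)"
    proof
      fix v assume v: "v \<in> A \<union> E a - U"
      show "v \<in> (\<Union>a<m. ?F a)"
      proof (cases "v \<in> A")
        case True
        then obtain b where b: "b < m" "v \<in> F b" using F v by (auto simp: Q_def)
        with Fa have "v \<in> ?F b" by auto
        with b show ?thesis by blast
      next
        case False
        then have "v \<in> ?F a" using v by simp
        with a show ?thesis by blast
      qed
    qed
    moreover have "?F b \<subseteq> E b \<and> E b \<subseteq> A \<union> E a \<and> card (?F b) \<le> k - r"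
      if "b < m" "?F b \<noteq> {}" for b
      using that F le2 by (cases "b = a") (auto simp: Q_def)
    ultimately have "Q (A \<union> E a) ?F"
      using F ES unfolding Q_def by blast
    then have "card (A \<union> E a) \<le> card A" using max by blast
    moreover have "card A < card (A \<union> E a)"
      using nsub finA fin[OF a] by (intro psubset_card_mono) auto
    ultimately show False by simp
  qed
  then have "A = S" using peel_closure_least[of U A r m E] F S by (auto simp: Q_def)
  then show ?thesis using F by (auto simp: Q_def)
qed

section \<open>From zero-optimal solutions to the peeling closure\<close>

lemma local_input_in_cube:
  assumes "ta \<in> tuples n k" "xs \<in> cube q n"
  shows "local_input k ta xs \<in> cube q k"
  using assms by (auto simp: local_input_def tuples_def cube_def PiE_iff)

lemma finite_cube: "finite (cube q k)"
  by (auto simp: cube_def intro: finite_PiE)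

text \<open>The objective is a sum of nonnegative terms, so objective value 0 forces every single
  term to vanish.\<close>

lemma zero_optimal_support:
  assumes zo: "zero_optimal q k r n m uu f t xs bi ba" and a: "a < m"
    and x: "x \<in> cube q k" "ba a x \<noteq> 0"
  shows "agree (k-r+1) (f a x) (f a (local_input k (t a) xs))"
proof (rule ccontr)
  assume neg: "\<not> ?thesis"
  have nn: "0 \<le> ba a x" if "a < m" "x \<in> cube q k" for a x
    using zo that by (auto simp: zero_optimal_def lp_feasible_def is_dist_def)
  have "(\<Sum>a<m. \<Sum>x\<in>cube q k.
        ba a x * (if agree (k-r+1) (f a x) (f a (local_input k (t a) xs)) then 0 else 1)) = 0"
    using zo by (simp add: zero_optimal_def lp_objective_def)
  then have "(\<Sum>x\<in>cube q k.
        ba a x * (if agree (k-r+1) (f a x) (f a (local_input k (t a) xs)) then 0 else 1)) = 0"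
    using a by (subst (asm) sum_nonneg_eq_0_iff) (auto intro!: sum_nonneg nn)
  then have "ba a x * (if agree (k-r+1) (f a x) (f a (local_input k (t a) xs)) then 0 else 1) = 0"
    using x(1) finite_cube nn[OF a] by (subst (asm) sum_nonneg_eq_0_iff) auto
  then show False using neg x(2) by simp
qed

text \<open>Two points of one fibre that agree in \<open>r - 1\<close> of the \<open>k\<close>
  coordinates differ in at most \<open>k - r + 1\<close>, which is below the minimum
  distance.\<close>

lemma mds_inverse_image_unique:
  assumes mds: "mds_inverse_image q k r f" and "r \<le> k" "1 \<le> r"
    and x: "x \<in> cube q k" "x' \<in> cube q k" and ag: "agree (k-r+1) (f x) (f x')"
    and card: "r - 1 \<le> card {s\<in>{..<k}. x s = x' s}"
  shows "x = x'"
proof (rule ccontr)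
  assume ne: "x \<noteq> x'"
  \<comment> \<open>Values of \<open>f x'\<close> at indices from \<open>k-r+1\<close> on are
    arbitrary; restricting produces an element of the cube that \<open>agree\<close> cannot tell
    apart from \<open>f x'\<close>.\<close>
  define y where "y = restrict (f x') {..<k-r+1}"
  have y: "y \<in> cube q (k-r+1)"
    using mds x by (auto simp: mds_inverse_image_def cube_def y_def)
  have "agree (k-r+1) (f x) y" "agree (k-r+1) (f x') y"
    using ag by (auto simp: agree_def y_def)
  then have "k - r + 2 \<le> card {s\<in>{..<k}. x s \<noteq> x' s}"
    using mds y x ne by (auto simp: mds_inverse_image_def)
  moreover have "card {s\<in>{..<k}. x s = x' s} + card {s\<in>{..<k}. x s \<noteq> x' s} = k"
  proof -
    have "card ({s\<in>{..<k}. x s = x' s} \<union> {s\<in>{..<k}. x s \<noteq> x' s}) = k"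
      by (rule trans[of _ "card {..<k}"], rule arg_cong[where f = card]) auto
    then show ?thesis by (subst (asm) card_Un_disjoint) auto
  qed
  ultimately show False using card assms(2,3) by linarith
qed

lemma is_dist_point:
  assumes "is_dist A p" "finite A" "x \<in> A" "p x = 1" "y \<in> A" "y \<noteq> x"
  shows "p y = 0"
proof -
  have "sum p A = p x + sum p (A - {x})" using assms by (simp add: sum.remove)
  then have "sum p (A - {x}) = 0" using assms by (simp add: is_dist_def)
  then show ?thesis using assms by (subst (asm) sum_nonneg_eq_0_iff) (auto simp: is_dist_def)
qed

text \<open>Frozen positions of a constraint pin every point in the support of \<open>ba a\<close>
  to the planted local input there. With \<open>r - 1\<close> such positions the MDS property leaves
  a single support point, and its marginals freeze the remaining positions too.\<close>

lemma zero_optimal_peel_closed: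
  assumes zo: "zero_optimal q k r n m uu f t xs bi ba" and t: "t \<in> hypergraphs n k m"
    and xs: "xs \<in> cube q n" and "r \<le> k" "1 \<le> r"
    and mds: "\<And>a. a < m \<Longrightarrow> mds_inverse_image q k r (f a)"
  shows "peel_closed (r - 1) m (\<lambda>a. t a ` {..<k}) {i\<in>{..<n}. bi i (xs i) = 1}"
  unfolding peel_closed_def
proof (intro allI impI)
  let ?I = "{i\<in>{..<n}. bi i (xs i) = 1}"
  fix a assume a: "a < m" and le: "r - 1 \<le> card (t a ` {..<k} \<inter> ?I)"
  have ta: "t a \<in> tuples n k" using t a by (auto simp: hypergraphs_def)
  then have ran: "t a s < n" if "s < k" for s using that by (auto simp: tuples_def)
  have xsq: "xs i < q" if "i < n" for i using xs that by (auto simp: cube_def)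
  have dist: "is_dist {..<q} (bi i)" if "i < n" for i
    using zo that by (auto simp: zero_optimal_def lp_feasible_def)
  have mdsa: "mds_inverse_image q k r (f a)" using mds a by blast
  have dista: "is_dist (cube q k) (ba a)"
    using zo a by (auto simp: zero_optimal_def lp_feasible_def)
  have marg: "sum (ba a) {x\<in>cube q k. x s = v} = bi (t a s) v" if "s < k" "v < q" for s v
    using zo a that by (auto simp: zero_optimal_def lp_feasible_def)
  \<comment> \<open>The threshold counts vertices, while the MDS property counts positions. Passing
    to positions is safe because an image has at most as many elements as its source.\<close>
  define P where "P = {s\<in>{..<k}. t a s \<in> ?I}"
  have "t a ` {..<k} \<inter> ?I = t a ` P" by (auto simp: P_def)
  then have cardP: "r - 1 \<le> card P"
    using le card_image_le[of P "t a"] by (simp add: P_def)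
  define z where "z = local_input k (t a) xs"
  have zc: "z \<in> cube q k" using local_input_in_cube[OF ta xs] by (simp add: z_def)
  have zs: "z s = xs (t a s)" if "s < k" for s using that by (simp add: z_def local_input_def)
  \<comment> \<open>At a frozen position the marginal gives mass 0 to every value other than the
    planted one, hence mass 0 to each \<open>x\<close> carrying such a value.\<close>
  have on_P: "x s = z s" if x: "x \<in> cube q k" "ba a x \<noteq> 0" and s: "s \<in> P" for x s
  proof (rule ccontr)
    assume ne: "x s \<noteq> z s"
    have sk: "s < k" and one: "bi (t a s) (xs (t a s)) = 1" using s by (auto simp: P_def)
    have xq: "x s < q" using x sk by (auto simp: cube_def)
    have "bi (t a s) (x s) = 0"
      using is_dist_point[OF dist[OF ran[OF sk]], of "xs (t a s)" "x s"] xsq[OF ran[OF sk]]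
        one xq ne zs[OF sk] by auto
    then have "sum (ba a) {x'\<in>cube q k. x' s = x s} = 0" using marg[OF sk xq] by simp
    then have "ba a x = 0" using x dista finite_cube
      by (subst (asm) sum_nonneg_eq_0_iff) (auto simp: is_dist_def)
    then show False using x by simp
  qed
  have only_z: "ba a x = 0" if x: "x \<in> cube q k" "x \<noteq> z" for x
  proof (rule ccontr)
    assume nz: "ba a x \<noteq> 0"
    have "card P \<le> card {s\<in>{..<k}. x s = z s}"
      using on_P[OF x(1) nz] by (intro card_mono) (auto simp: P_def)
    then have "r - 1 \<le> card {s\<in>{..<k}. x s = z s}" using cardP by linarith
    moreover have "agree (k-r+1) (f a x) (f a z)"
      unfolding z_def by (rule zero_optimal_support[OF zo, OF a x(1) nz])
    ultimately have "x = z"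
      by (intro mds_inverse_image_unique[where f = "f a" and q = q and k = k and r = r])
        (use mdsa assms(4,5) x(1) zc in auto)
    then show False using x by simp
  qed
  have "sum (ba a) (cube q k) = sum (ba a) {z}"
    using only_z zc finite_cube by (intro sum.mono_neutral_right) auto
  then have z1: "ba a z = 1" using dista by (simp add: is_dist_def)
  show "t a ` {..<k} \<subseteq> ?I"
  proof
    fix i assume "i \<in> t a ` {..<k}"
    then obtain s where s: "s < k" "i = t a s" by auto
    have "sum (ba a) {x\<in>cube q k. x s = z s} = sum (ba a) {z}"
      using only_z zc finite_cube by (intro sum.mono_neutral_right) auto
    then have "bi (t a s) (xs (t a s)) = 1"
      using marg[OF s(1) xsq[OF ran[OF s(1)]]] zs[OF s(1)] z1 by simp
    then show "i \<in> ?I" using s ran by auto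
  qed
qed

text \<open>The variables frozen at their planted values contain the seeds and are closed under
  absorption, so they contain the smallest set with both properties.\<close>

lemma integral_part_ge_closure:
  assumes zo: "zero_optimal q k r n m uu f t xs bi ba" and t: "t \<in> hypergraphs n k m"
    and xs: "xs \<in> cube q n" and "r \<le> k" "1 \<le> r" "uu \<le> n"
    and mds: "\<And>a. a < m \<Longrightarrow> mds_inverse_image q k r (f a)"
  shows "card (peel_closure (r - 1) m (\<lambda>a. t a ` {..<k}) {..<uu}) \<le> card (integral_part q n bi)"
proof (rule card_mono)
  show "finite (integral_part q n bi)" by (simp add: integral_part_def)
  have "{..<uu} \<subseteq> {i\<in>{..<n}. bi i (xs i) = 1}"
    using zo assms(6) unfolding zero_optimal_def lp_feasible_def by fastforce
  moreover have "peel_closed (r - 1) m (\<lambda>a. t a ` {..<k}) {i\<in>{..<n}. bi i (xs i) = 1}"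
    by (rule zero_optimal_peel_closed[OF zo]) (use t xs assms(4,5) mds in auto)
  ultimately have "peel_closure (r - 1) m (\<lambda>a. t a ` {..<k}) {..<uu} \<subseteq> {i\<in>{..<n}. bi i (xs i) = 1}"
    by (rule peel_closure_least)
  then show "peel_closure (r - 1) m (\<lambda>a. t a ` {..<k}) {..<uu} \<subseteq> integral_part q n bi"
    using xs by (auto simp: integral_part_def cube_def)
qed

section \<open>Counting hypergraphs by their closure\<close>

lemma sum_Pow_card:
  fixes g :: "nat \<Rightarrow> real"
  assumes "finite W"
  shows "(\<Sum>Q\<in>Pow W. g (card Q)) = (\<Sum>j\<le>card W. real (card W choose j) * g j)"
proof -
  have "(\<Sum>Q\<in>Pow W. g (card Q)) = (\<Sum>j\<le>card W. \<Sum>Q\<in>{Q\<in>Pow W. card Q = j}. g (card Q))"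
    using assms by (intro sum.group[symmetric]) (auto intro: card_mono)
  also have "\<dots> = (\<Sum>j\<le>card W. real (card W choose j) * g j)"
  proof (intro sum.cong refl)
    fix j
    have "(\<Sum>Q\<in>{Q\<in>Pow W. card Q = j}. g (card Q)) = real (card {Q\<in>Pow W. card Q = j}) * g j"
      by (subst sum.cong[OF refl, of _ _ "\<lambda>_. g j"]) auto
    then show "(\<Sum>Q\<in>{Q\<in>Pow W. card Q = j}. g (card Q)) = real (card W choose j) * g j"
      using n_subsets[OF assms, of j] by simp
  qed
  finally show ?thesis .
qed

text \<open>Each vertex in \<open>F a\<close> is charged to the edge \<open>H a\<close>.\<close>

definition coverings :: "'e set \<Rightarrow> ('e \<Rightarrow> 'v set \<Rightarrow> bool) \<Rightarrow> nat \<Rightarrow> 'v set \<Rightarrow> (nat \<Rightarrow> 'e) set" where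
  "coverings T ok m W =
     {H \<in> PiE {..<m} (\<lambda>_. T). \<exists>F. W \<subseteq> (\<Union>a<m. F a) \<and> (\<forall>a<m. ok (H a) (F a))}"

text \<open>The last edge is split off together with the part \<open>Q\<close> of \<open>W\<close>
  it pays for; the other edges cover the rest. Cutting its charge down to a subset of
  \<open>W\<close> is where antitonicity of \<open>ok\<close> enters.\<close>

lemma coverings_Suc:
  assumes mono: "\<And>e Q Q'. ok e Q \<Longrightarrow> Q' \<subseteq> Q \<Longrightarrow> ok e Q'"
  shows "coverings T ok (Suc m) W \<subseteq>
    (\<Union>Q\<in>Pow W. (\<lambda>(H, e). H(m := e)) ` (coverings T ok m (W - Q) \<times> {e\<in>T. ok e Q}))"
proof
  fix H assume "H \<in> coverings T ok (Suc m) W"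
  then have H: "H \<in> PiE {..<Suc m} (\<lambda>_. T)"
    and "\<exists>F. W \<subseteq> (\<Union>a<Suc m. F a) \<and> (\<forall>a<Suc m. ok (H a) (F a))"
    unfolding coverings_def by auto
  then obtain F where W: "W \<subseteq> (\<Union>a<Suc m. F a)"
    and ok: "\<forall>a<Suc m. ok (H a) (F a)" by (elim exE conjE)
  define Q where "Q = W \<inter> F m"
  define H' where "H' = restrict H {..<m}"
  have "H' \<in> PiE {..<m} (\<lambda>_. T)"
    using H by (simp add: H'_def PiE_iff)
  moreover have "W - Q \<subseteq> (\<Union>a<m. F a)" using W by (auto simp: Q_def lessThan_Suc)
  moreover have "\<forall>a<m. ok (H' a) (F a)" using ok by (auto simp: H'_def)
  ultimately have 1: "H' \<in> coverings T ok m (W - Q)" by (auto simp: coverings_def)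
  have 2: "H m \<in> {e\<in>T. ok e Q}"
    using H mono[of "H m" "F m" Q] ok by (auto simp: Q_def)
  have "H = H'(m := H m)"
    using H by (auto simp: H'_def fun_eq_iff PiE_iff extensional_def)
  then have "H \<in> (\<lambda>(H, e). H(m := e)) ` (coverings T ok m (W - Q) \<times> {e\<in>T. ok e Q})"
    using 1 2 by (intro image_eqI[of _ _ "(H', H m)"]) auto
  moreover have "Q \<in> Pow W" by (auto simp: Q_def)
  ultimately show "H \<in> (\<Union>Q\<in>Pow W.
      (\<lambda>(H, e). H(m := e)) ` (coverings T ok m (W - Q) \<times> {e\<in>T. ok e Q}))" by blast
qed

text \<open>The polynomial is an exponential generating function for the vertex sets charged to one
  edge, and its \<open>m\<close>-th power belongs to \<open>m\<close> edges. A coefficient of a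
  polynomial with nonnegative coefficients is at most its value at \<open>x\<close> divided by the
  matching power of \<open>x\<close>. The induction on \<open>m\<close> performs both steps at
  once.\<close>

lemma card_coverings_le:
  fixes h :: "nat \<Rightarrow> real" and x :: real
  assumes finT: "finite T" and finW: "finite W" and x: "x > 0"
    and mono: "\<And>e Q Q'. ok e Q \<Longrightarrow> Q' \<subseteq> Q \<Longrightarrow> ok e Q'"
    and bound: "\<And>Q. Q \<subseteq> W \<Longrightarrow> real (card {e\<in>T. ok e Q}) \<le> h (card Q)"
    and h: "\<And>j. 0 \<le> h j" "\<And>j. d < j \<Longrightarrow> h j = 0"
  shows "real (card (coverings T ok m W))
           \<le> fact (card W) * (\<Sum>j\<le>d. h j * x ^ j / fact j) ^ m / x ^ card W"
  \<comment> \<open>Both facts mention \<open>W\<close> and must be generalised with it, because the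
    induction hypothesis is applied to \<open>W - Q\<close>.\<close>
  using finW bound
proof (induction m arbitrary: W)
  case 0
  show ?case
  proof (cases "W = {}")
    case True
    then show ?thesis by (simp add: coverings_def)
  next
    case False
    then have "coverings T ok 0 W = {}" by (auto simp: coverings_def)
    then show ?thesis using x by simp
  qed
next
  case (Suc m)
  define B where "B = (\<Sum>j\<le>d. h j * x ^ j / fact j)"
  have B0: "0 \<le> B" using h(1) x by (auto simp: B_def intro!: sum_nonneg)
  have fin: "finite (coverings T ok m V)" for V
    using finT by (auto simp: coverings_def intro!: finite_subset[OF _ finite_PiE[of "{..<m}" "\<lambda>_. T"]])
  let ?w = "card W"
  have sub: "coverings T ok (Suc m) W \<subseteq>
    (\<Union>Q\<in>Pow W. (\<lambda>(H, e). H(m := e)) ` (coverings T ok m (W - Q) \<times> {e\<in>T. ok e Q}))"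
    by (rule coverings_Suc) (rule mono)
  have "real (card (coverings T ok (Suc m) W))
      \<le> real (\<Sum>Q\<in>Pow W. card ((\<lambda>(H, e). H(m := e)) ` (coverings T ok m (W - Q) \<times> {e\<in>T. ok e Q})))"
    unfolding of_nat_le_iff
    using Suc.prems(1) fin finT
    by (intro order.trans[OF card_mono[OF _ sub] card_UN_le]) auto
  also have "\<dots> \<le> (\<Sum>Q\<in>Pow W. real (card (coverings T ok m (W - Q))) * real (card {e\<in>T. ok e Q}))"
    unfolding of_nat_sum
  proof (rule sum_mono)
    fix Q
    have "card ((\<lambda>(H, e). H(m := e)) ` (coverings T ok m (W - Q) \<times> {e\<in>T. ok e Q}))
        \<le> card (coverings T ok m (W - Q)) * card {e\<in>T. ok e Q}"
      unfolding card_cartesian_product[symmetric] using fin finT by (intro card_image_le) auto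
    then show "real (card ((\<lambda>(H, e). H(m := e)) ` (coverings T ok m (W - Q) \<times> {e\<in>T. ok e Q})))
        \<le> real (card (coverings T ok m (W - Q))) * real (card {e\<in>T. ok e Q})"
      unfolding of_nat_mult[symmetric] of_nat_le_iff .
  qed
  also have "\<dots> \<le> (\<Sum>Q\<in>Pow W. (fact (?w - card Q) * B ^ m / x ^ (?w - card Q)) * h (card Q))"
  proof (rule sum_mono)
    fix Q assume Q: "Q \<in> Pow W"
    then have c: "card (W - Q) = ?w - card Q"
      using Suc.prems(1) by (intro card_Diff_subset) (auto intro: finite_subset)
    have "real (card (coverings T ok m (W - Q))) \<le> fact (?w - card Q) * B ^ m / x ^ (?w - card Q)"
      unfolding B_def c[symmetric] using Suc.prems by (intro Suc.IH) auto
    then show "real (card (coverings T ok m (W - Q))) * real (card {e\<in>T. ok e Q})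
        \<le> (fact (?w - card Q) * B ^ m / x ^ (?w - card Q)) * h (card Q)"
      using Suc.prems(2)[of Q] Q B0 x by (intro mult_mono) auto
  qed
  also have "\<dots> = (\<Sum>j\<le>?w. real (?w choose j) * (fact (?w - j) * B ^ m / x ^ (?w - j) * h j))"
    by (rule sum_Pow_card[OF Suc.prems(1), of "\<lambda>j. fact (?w - j) * B ^ m / x ^ (?w - j) * h j"])
  also have "\<dots> = (\<Sum>j\<le>?w. fact ?w * B ^ m / x ^ ?w * (h j * x ^ j / fact j))"
  proof (intro sum.cong refl)
    \<comment> \<open>Choosing the \<open>j\<close> vertices paid for by the last edge cancels
      \<open>fact (?w - j)\<close> and leaves the weight \<open>1 / fact j\<close>.\<close>
    fix j assume j: "j \<in> {..?w}"
    have "x ^ ?w = x ^ j * x ^ (?w - j)" using j by (simp flip: power_add)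
    moreover have "real (?w choose j) * fact (?w - j) = fact ?w / fact j"
      using j by (simp add: binomial_fact)
    ultimately show "real (?w choose j) * (fact (?w - j) * B ^ m / x ^ (?w - j) * h j)
        = fact ?w * B ^ m / x ^ ?w * (h j * x ^ j / fact j)"
      using x by (simp add: field_simps)
  qed
  also have "\<dots> = fact ?w * B ^ m / x ^ ?w * (\<Sum>j\<le>?w. h j * x ^ j / fact j)"
    by (simp add: sum_distrib_left)
  also have "\<dots> \<le> fact ?w * B ^ m / x ^ ?w * B"
  proof (rule mult_left_mono)
    have "(\<Sum>j\<le>?w. h j * x ^ j / fact j) = (\<Sum>j\<in>{..?w} \<inter> {..d}. h j * x ^ j / fact j)"
      using h(2) by (intro sum.mono_neutral_right) auto
    also have "\<dots> \<le> B" unfolding B_def using h(1) x by (intro sum_mono2) auto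
    finally show "(\<Sum>j\<le>?w. h j * x ^ j / fact j) \<le> B" .
  qed (use B0 x in auto)
  finally show ?case unfolding B_def[symmetric] by (simp add: mult_ac)
qed

section \<open>Counting tuples relative to a vertex set\<close>

text \<open>Entries are chosen one after the other, each avoiding the fewer than \<open>K\<close>
  values already used. The fixed loss \<open>K\<close> keeps the factors uniform, and truncated
  subtraction makes the bound trivial when some \<open>X s\<close> is small.\<close>

lemma card_inj_PiE_ge:
  fixes X :: "nat \<Rightarrow> 'a set"
  assumes "\<And>s. s < j \<Longrightarrow> finite (X s)" "j \<le> K"
  shows "(\<Prod>s<j. card (X s) - K) \<le> card {e \<in> PiE {..<j} X. inj_on e {..<j}}"
  using assms
proof (induction j)
  case 0
  then show ?case by simp
next
  case (Suc j)
  let ?A = "{e \<in> PiE {..<j} X. inj_on e {..<j}}"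
  have fin: "finite ?A" using Suc.prems by (intro finite_subset[OF _ finite_PiE[of "{..<j}" X]]) auto
  have "(\<Prod>s<Suc j. card (X s) - K) \<le> card ?A * (card (X j) - K)"
    using Suc by simp
  also have "\<dots> = (\<Sum>e\<in>?A. card (X j) - K)" by simp
  also have "\<dots> \<le> (\<Sum>e\<in>?A. card (X j - e ` {..<j}))"
  proof (rule sum_mono)
    fix e :: "nat \<Rightarrow> 'a"
    have "card (X j) - K \<le> card (X j) - card (e ` {..<j})"
      using card_image_le[of "{..<j}" e] Suc.prems(2) by simp
    also have "\<dots> \<le> card (X j - e ` {..<j})" by (rule diff_card_le_card_Diff) simp
    finally show "card (X j) - K \<le> card (X j - e ` {..<j})" .
  qed
  also have "\<dots> = card (SIGMA e:?A. X j - e ` {..<j})"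
    using fin Suc.prems by (intro card_SigmaI[symmetric]) auto
  also have "\<dots> \<le> card {e \<in> PiE {..<Suc j} X. inj_on e {..<Suc j}}"
  proof (rule card_inj_on_le[where f = "\<lambda>(e, y). e(j := y)"])
    show "inj_on (\<lambda>(e, y). e(j := y)) (SIGMA e:?A. X j - e ` {..<j})"
    proof (rule inj_onI, clarify)
      fix e y e' y'
      assume e: "e \<in> PiE {..<j} X" "e' \<in> PiE {..<j} X" and eq: "e(j := y) = e'(j := y')"
      have "e i = e' i" for i
        using fun_cong[OF eq, of i] e by (cases "i = j") (auto simp: PiE_iff extensional_def)
      then show "e = e' \<and> y = y'" using fun_cong[OF eq, of j] by auto
    qed
    show "(\<lambda>(e, y). e(j := y)) ` (SIGMA e:?A. X j - e ` {..<j})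
        \<subseteq> {e \<in> PiE {..<Suc j} X. inj_on e {..<Suc j}}"
      by (auto simp: lessThan_Suc inj_on_def PiE_iff extensional_def image_iff)
    show "finite {e \<in> PiE {..<Suc j} X. inj_on e {..<Suc j}}"
      using Suc.prems by (intro finite_subset[OF _ finite_PiE[of "{..<Suc j}" X]]) auto
  qed
  finally show ?case .
qed

lemma finite_tuples: "finite (tuples n k)"
  unfolding tuples_def by (intro finite_subset[OF _ finite_PiE[of "{..<k}" "\<lambda>_. {..<n}"]]) auto

lemma card_tuples_le: "card (tuples n k) \<le> n ^ k"
proof -
  have "card (tuples n k) \<le> card (PiE {..<k} (\<lambda>_. {..<n}))"
    unfolding tuples_def by (intro card_mono finite_PiE) auto
  then show ?thesis by (simp add: card_PiE)
qed

lemma card_tuples_ge: "(n - k) ^ k \<le> card (tuples n k)"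
  using card_inj_PiE_ge[of k "\<lambda>_. {..<n}" k] by (simp add: tuples_def)

text \<open>For each choice \<open>P\<close> of \<open>p\<close> positions, the entries at
  \<open>P\<close> are taken in \<open>S\<close> and all others outside. A tuple determines its
  \<open>P\<close>, so the resulting classes are disjoint and their sizes add up.\<close>

lemma card_tuples_meeting_ge:
  assumes S: "S \<subseteq> {..<n}" and "p \<le> k"
  shows "(k choose p) * ((card S - k) ^ p * (n - card S - k) ^ (k - p))
          \<le> card {e \<in> tuples n k. card (e ` {..<k} \<inter> S) = p}"
proof -
  define X where "X P s = (if s \<in> P then S else {..<n} - S)" for P :: "nat set" and s :: nat
  define A where "A P = {e \<in> PiE {..<k} (X P). inj_on e {..<k}}" for P
  define \<P> where "\<P> = {P \<in> Pow {..<k}. card P = p}"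
  have finS: "finite S" using S finite_subset by blast
  have XF: "X P s \<subseteq> {..<n}" for P s using S by (auto simp: X_def)
  have preim: "{s\<in>{..<k}. e s \<in> S} = P" if "e \<in> A P" "P \<in> \<P>" for e P
  proof -
    have "e s \<in> X P s" if "s < k" for s using \<open>e \<in> A P\<close> that by (auto simp: A_def)
    then show ?thesis using that by (fastforce simp: X_def \<P>_def split: if_splits)
  qed
  have AP: "A P \<subseteq> {e \<in> tuples n k. card (e ` {..<k} \<inter> S) = p}" if P: "P \<in> \<P>" for P
  proof
    fix e assume e: "e \<in> A P"
    have "e \<in> tuples n k" using e XF by (fastforce simp: A_def tuples_def PiE_iff)
    moreover have "e ` {..<k} \<inter> S = e ` P" using preim[OF e P] by auto
    moreover have "card (e ` P) = p"
      using e P by (subst card_image) (auto simp: A_def \<P>_def intro: inj_on_subset)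
    ultimately show "e \<in> {e \<in> tuples n k. card (e ` {..<k} \<inter> S) = p}" by simp
  qed
  have cardA: "(card S - k) ^ p * (n - card S - k) ^ (k - p) \<le> card (A P)" if P: "P \<in> \<P>" for P
  proof -
    have P': "P \<subseteq> {..<k}" "card P = p" using P by (auto simp: \<P>_def)
    have "(\<Prod>s<k. card (X P s) - k) = (\<Prod>s<k. if s \<in> P then card S - k else n - card S - k)"
      using finS S by (intro prod.cong) (auto simp: X_def card_Diff_subset)
    also have "\<dots> = (card S - k) ^ card ({..<k} \<inter> P) * (n - card S - k) ^ card ({..<k} \<inter> - P)"
      by (simp add: prod.If_cases)
    also have "{..<k} \<inter> P = P" using P' by auto
    also have "card ({..<k} \<inter> - P) = k - p"
      using P' by (subst Diff_eq[symmetric], subst card_Diff_subset) (auto intro: finite_subset)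
    finally show ?thesis
      using card_inj_PiE_ge[of k "X P" k] XF finite_subset P' by (fastforce simp: A_def)
  qed
  have finA: "finite (A P)" if "P \<in> \<P>" for P
    using AP[OF that] finite_tuples by (auto intro: finite_subset)
  have "(k choose p) * ((card S - k) ^ p * (n - card S - k) ^ (k - p))
      = (\<Sum>P\<in>\<P>. (card S - k) ^ p * (n - card S - k) ^ (k - p))"
    using n_subsets[of "{..<k}" p] by (simp add: \<P>_def)
  also have "\<dots> \<le> (\<Sum>P\<in>\<P>. card (A P))" using cardA by (rule sum_mono)
  also have "\<dots> = card (\<Union>P\<in>\<P>. A P)"
  proof (rule card_UN_disjoint[symmetric])
    show "finite \<P>" by (simp add: \<P>_def)
    show "\<forall>P\<in>\<P>. finite (A P)" using finA by blast
    show "\<forall>P\<in>\<P>. \<forall>P'\<in>\<P>. P \<noteq> P' \<longrightarrow> A P \<inter> A P' = {}"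
    proof (intro ballI impI equals0I)
      fix P P' e assume "P \<in> \<P>" "P' \<in> \<P>" "P \<noteq> P'" "e \<in> A P \<inter> A P'"
      then show False using preim[of e P] preim[of e P'] by simp
    qed
  qed
  also have "\<dots> \<le> card {e \<in> tuples n k. card (e ` {..<k} \<inter> S) = p}"
    using AP finite_tuples by (intro card_mono) auto
  finally show ?thesis .
qed

text \<open>An injection \<open>\<phi>\<close> records the position of each vertex of
  \<open>Q\<close>. The remaining positions range freely over \<open>S\<close>; ignoring
  distinctness there only increases the count.\<close>

lemma card_tuples_containing_le:
  assumes S: "S \<subseteq> {..<n}" and "Q \<subseteq> S"
  shows "card {e \<in> tuples n k. Q \<subseteq> e ` {..<k} \<and> e ` {..<k} \<subseteq> S}
          \<le> (k choose card Q) * fact (card Q) * card S ^ (k - card Q)"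
proof -
  have finS: "finite S" using S finite_subset by blast
  then have finQ: "finite Q" using assms(2) by (rule rev_finite_subset)
  define \<Phi> where "\<Phi> = {\<phi> \<in> Q \<rightarrow>\<^sub>E {..<k}. inj_on \<phi> Q}"
  define A where "A \<phi> = PiE {..<k} (\<lambda>s. if s \<in> \<phi> ` Q then {inv_into Q \<phi> s} else S)" for \<phi> :: "nat \<Rightarrow> nat"
  have fin\<Phi>: "finite \<Phi>"
    unfolding \<Phi>_def using finQ by (intro finite_subset[OF _ finite_PiE[of Q "\<lambda>_. {..<k}"]]) auto
  have finA: "finite (A \<phi>)" for \<phi> using finS by (auto simp: A_def intro!: finite_PiE)
  have sub: "{e \<in> tuples n k. Q \<subseteq> e ` {..<k} \<and> e ` {..<k} \<subseteq> S} \<subseteq> (\<Union>\<phi>\<in>\<Phi>. A \<phi>)"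
  proof
    fix e assume "e \<in> {e \<in> tuples n k. Q \<subseteq> e ` {..<k} \<and> e ` {..<k} \<subseteq> S}"
    then have e: "e \<in> extensional {..<k}" "inj_on e {..<k}" "Q \<subseteq> e ` {..<k}" "e ` {..<k} \<subseteq> S"
      by (auto simp: tuples_def PiE_iff)
    define \<phi> where "\<phi> = restrict (inv_into {..<k} e) Q"
    have \<phi>: "\<phi> v < k" "e (\<phi> v) = v" if "v \<in> Q" for v
      using e(3) that inv_into_into[of v e "{..<k}"] f_inv_into_f[of v e "{..<k}"]
      by (auto simp: \<phi>_def)
    have inj: "inj_on \<phi> Q" using \<phi>(2) by (intro inj_on_inverseI)
    then have "\<phi> \<in> \<Phi>" using \<phi>(1) by (auto simp: \<Phi>_def \<phi>_def)
    moreover have "e \<in> A \<phi>"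
      unfolding A_def using e inj \<phi> by (auto simp: PiE_iff)
    ultimately show "e \<in> (\<Union>\<phi>\<in>\<Phi>. A \<phi>)" by blast
  qed
  have cardA: "card (A \<phi>) = card S ^ (k - card Q)" if "\<phi> \<in> \<Phi>" for \<phi>
  proof -
    have im: "\<phi> ` Q \<subseteq> {..<k}" "card (\<phi> ` Q) = card Q"
      using that by (auto simp: \<Phi>_def card_image)
    have "card (A \<phi>) = (\<Prod>s<k. if s \<in> \<phi> ` Q then 1 else card S)"
      unfolding A_def by (subst card_PiE) (auto intro!: prod.cong)
    also have "\<dots> = card S ^ card ({..<k} \<inter> - \<phi> ` Q)"
      by (simp add: prod.If_cases)
    also have "card ({..<k} \<inter> - \<phi> ` Q) = k - card Q"
      using im by (subst Diff_eq[symmetric], subst card_Diff_subset) (auto intro: finite_subset)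
    finally show ?thesis .
  qed
  have card\<Phi>: "card \<Phi> \<le> (k choose card Q) * fact (card Q)"
  proof -
    have "card \<Phi> = (\<Prod>i=0..<card Q. k - i)"
      using card_inj_on_subset_funcset[of Q "{..<k}" Q] finQ by (simp add: \<Phi>_def)
    \<comment> \<open>For \<open>card Q \<le> k\<close> this falling factorial equals the right-hand
      side; otherwise the factor at \<open>i = k\<close> is zero.\<close>
    also have "\<dots> \<le> (k choose card Q) * fact (card Q)"
    proof (cases "card Q \<le> k")
      case True
      have "(\<Prod>i=0..<card Q. real (k - i)) = (\<Prod>i=0..<card Q. real k - real i)"
        using True by (intro prod.cong) (auto simp: of_nat_diff)
      also have "\<dots> = fact (card Q) * (real k gchoose card Q)"
        by (simp add: gbinomial_prod_rev)
      also have "\<dots> = real ((k choose card Q) * fact (card Q))"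
        by (simp flip: binomial_gbinomial)
      finally show ?thesis unfolding of_nat_prod[symmetric] of_nat_eq_iff by simp
    next
      case False
      have "(\<Prod>i=0..<card Q. k - i) = 0"
        by (rule prod_zero) (use False in \<open>auto intro!: bexI[of _ k]\<close>)
      then show ?thesis by linarith
    qed
    finally show ?thesis .
  qed
  have "card {e \<in> tuples n k. Q \<subseteq> e ` {..<k} \<and> e ` {..<k} \<subseteq> S} \<le> (\<Sum>\<phi>\<in>\<Phi>. card (A \<phi>))"
    using sub fin\<Phi> finA by (intro order.trans[OF card_mono card_UN_le]) auto
  also have "\<dots> = card \<Phi> * card S ^ (k - card Q)" using cardA by simp
  also have "\<dots> \<le> (k choose card Q) * fact (card Q) * card S ^ (k - card Q)"
    using card\<Phi> by (intro mult_right_mono) auto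
  finally show ?thesis .
qed

section \<open>Union bound over the possible closures\<close>

definition edge_sets :: "nat \<Rightarrow> (nat \<Rightarrow> nat \<Rightarrow> nat) \<Rightarrow> nat \<Rightarrow> nat set" where
  "edge_sets k H a = H a ` {..<k}"

text \<open>A condition on one edge at a time, so that the count factors over the independent edges.
  The first conjunct says that the edge does not violate closedness of \<open>S\<close>; the second
  says that it may pay for \<open>Q\<close>.\<close>

definition consistent :: "nat \<Rightarrow> nat \<Rightarrow> nat set \<Rightarrow> (nat \<Rightarrow> nat) \<Rightarrow> nat set \<Rightarrow> bool" where
  "consistent k p S e Q \<longleftrightarrow> (p \<le> card (e ` {..<k} \<inter> S) \<longrightarrow> e ` {..<k} \<subseteq> S) \<and>
     (Q \<noteq> {} \<longrightarrow> Q \<subseteq> e ` {..<k} \<and> e ` {..<k} \<subseteq> S \<and> card Q \<le> k - p)"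

lemma consistent_antimono:
  assumes "consistent k p S e Q" "Q' \<subseteq> Q"
  shows "consistent k p S e Q'"
proof -
  have "card Q' \<le> card Q" if "Q \<subseteq> e ` {..<k}"
    using that assms(2) finite_subset[of Q "e ` {..<k}"] by (intro card_mono) auto
  then show ?thesis using assms unfolding consistent_def by (cases "Q = {}") (auto dest: order_trans)
qed

lemma closure_eq_imp_covering:
  assumes H: "H \<in> hypergraphs n k m" and "finite S"
    and S: "peel_closure p m (edge_sets k H) U = S"
  shows "H \<in> coverings (tuples n k) (consistent k p S) m (S - U)"
proof -
  have E: "finite (edge_sets k H a)" "card (edge_sets k H a) = k" if "a < m" for a
  proof -
    have "H a \<in> tuples n k" using H that by (auto simp: hypergraphs_def)
    then show "finite (edge_sets k H a)" "card (edge_sets k H a) = k"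
      by (simp_all add: edge_sets_def tuples_def card_image)
  qed
  have "\<exists>F. S - U \<subseteq> (\<Union>a<m. F a) \<and> (\<forall>a<m. F a \<noteq> {} \<longrightarrow>
      F a \<subseteq> edge_sets k H a \<and> edge_sets k H a \<subseteq> S \<and> card (F a) \<le> k - p)"
    by (rule peel_closure_witness[OF _ _ assms(2) S]) (use E in auto)
  then obtain F where F: "S - U \<subseteq> (\<Union>a<m. F a)" and
    Fa: "\<forall>a<m. F a \<noteq> {} \<longrightarrow> F a \<subseteq> edge_sets k H a \<and> edge_sets k H a \<subseteq> S \<and> card (F a) \<le> k - p"
    by (elim exE conjE)
  have "peel_closed p m (edge_sets k H) S"
    using peel_closed_closure[of m "edge_sets k H" p U] E(1) S by simp
  then have "\<forall>a<m. consistent k p S (H a) (F a)"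
    using Fa by (simp add: consistent_def peel_closed_def edge_sets_def)
  then show ?thesis using H F unfolding coverings_def hypergraphs_def by blast
qed

text \<open>Generating polynomial of a single edge relative to a set of \<open>s\<close> vertices: the summand of
  degree \<open>j\<close> accounts for the edges paying for \<open>j\<close> prescribed vertices (the factor
  \<open>fact j\<close> cancels against the exponential weight), the constant part for those paying for none.\<close>

definition step_bound :: "nat \<Rightarrow> nat \<Rightarrow> nat \<Rightarrow> nat \<Rightarrow> real \<Rightarrow> real" where
  "step_bound n k p s x = real (card (tuples n k))
     - real (k choose p) * (real (s - k) ^ p * real (n - s - k) ^ (k - p))
     + (\<Sum>j=1..k-p. real (k choose j) * real s ^ (k - j) * x ^ j)"

text \<open>This is the covering bound with \<open>W = S - U\<close>. An edge that pays for nothing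
  must still avoid meeting \<open>S\<close> in exactly \<open>p\<close> vertices, which yields the
  negative term of \<open>step_bound\<close>.\<close>

lemma card_closure_eq_le:
  assumes S: "S \<subseteq> {..<n}" and x: "x > 0" and p: "p < k"
  shows "real (card {H \<in> hypergraphs n k m. peel_closure p m (edge_sets k H) U = S})
          \<le> fact (card (S - U)) * step_bound n k p (card S) x ^ m / x ^ card (S - U)"
proof -
  define h where "h j = (if j = 0 then real (card {e \<in> tuples n k. consistent k p S e {}})
     else if j \<le> k - p then real (k choose j) * fact j * real (card S) ^ (k - j) else 0)" for j
  have finS: "finite S" using S finite_subset by blast
  have fin: "finite (coverings (tuples n k) (consistent k p S) m V)" for V
    using finite_tuples by (auto simp: coverings_def
        intro!: finite_subset[OF _ finite_PiE[of "{..<m}" "\<lambda>_. tuples n k"]])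
  have bound: "real (card {e \<in> tuples n k. consistent k p S e Q}) \<le> h (card Q)"
    if Q: "Q \<subseteq> S - U" for Q
  proof (cases "Q = {}")
    case True
    then show ?thesis by (simp add: h_def)
  next
    case False
    have "finite Q" using Q finS finite_subset by blast
    then have "card Q \<noteq> 0" using False by simp
    show ?thesis
    proof (cases "card Q \<le> k - p")
      case True
      have "card {e \<in> tuples n k. consistent k p S e Q}
          \<le> card {e \<in> tuples n k. Q \<subseteq> e ` {..<k} \<and> e ` {..<k} \<subseteq> S}"
        using finite_tuples False by (intro card_mono) (auto simp: consistent_def)
      also have "\<dots> \<le> (k choose card Q) * fact (card Q) * card S ^ (k - card Q)"
        using S Q by (intro card_tuples_containing_le) auto
      finally have "real (card {e \<in> tuples n k. consistent k p S e Q})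
          \<le> real ((k choose card Q) * fact (card Q) * card S ^ (k - card Q))"
        by (rule of_nat_mono)
      then show ?thesis using True \<open>card Q \<noteq> 0\<close> by (simp add: h_def)
    next
      case False
      then have none: "{e \<in> tuples n k. consistent k p S e Q} = {}"
        using \<open>Q \<noteq> {}\<close> by (auto simp: consistent_def)
      show ?thesis unfolding none using False \<open>card Q \<noteq> 0\<close> by (simp add: h_def)
    qed
  qed
  have h0: "h 0 \<le> real (card (tuples n k))
     - real (k choose p) * (real (card S - k) ^ p * real (n - card S - k) ^ (k - p))"
  proof -
    let ?A = "{e \<in> tuples n k. consistent k p S e {}}"
    let ?B = "{e \<in> tuples n k. card (e ` {..<k} \<inter> S) = p}"
    \<comment> \<open>A consistent edge with \<open>p\<close> vertices in \<open>S\<close> would lie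
      inside \<open>S\<close> and so have \<open>k = p\<close> vertices, contrary to
      \<open>p < k\<close>.\<close>
    have "?A \<inter> ?B = {}"
    proof -
      have False if e: "e \<in> tuples n k" "consistent k p S e {}" "card (e ` {..<k} \<inter> S) = p" for e
      proof -
        have "e ` {..<k} \<subseteq> S" using e by (simp add: consistent_def)
        then have "e ` {..<k} \<inter> S = e ` {..<k}" by auto
        then have "p = k" using e by (simp add: tuples_def card_image)
        then show False using p by simp
      qed
      then show ?thesis by blast
    qed
    then have "card ?A + card ?B = card (?A \<union> ?B)"
      using finite_tuples by (intro card_Un_disjoint[symmetric]) auto
    also have "\<dots> \<le> card (tuples n k)" using finite_tuples by (intro card_mono) auto
    finally have "card ?A + (k choose p) * ((card S - k) ^ p * (n - card S - k) ^ (k - p))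
        \<le> card (tuples n k)"
      using card_tuples_meeting_ge[OF S, of p k] p by linarith
    then have "real (card ?A + (k choose p) * ((card S - k) ^ p * (n - card S - k) ^ (k - p)))
        \<le> real (card (tuples n k))" by (rule of_nat_mono)
    then show ?thesis by (simp add: h_def)
  qed
  have "{..k-p} = insert 0 {1..k-p}" by auto
  then have "(\<Sum>j\<le>k-p. h j * x ^ j / fact j) = h 0 + (\<Sum>j=1..k-p. h j * x ^ j / fact j)"
    by simp
  also have "(\<Sum>j=1..k-p. h j * x ^ j / fact j)
      = (\<Sum>j=1..k-p. real (k choose j) * real (card S) ^ (k - j) * x ^ j)"
    by (intro sum.cong) (auto simp: h_def)
  finally have B: "(\<Sum>j\<le>k-p. h j * x ^ j / fact j) \<le> step_bound n k p (card S) x"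
    using h0 by (simp add: step_bound_def)
  have nn: "0 \<le> (\<Sum>j\<le>k-p. h j * x ^ j / fact j)"
    using x by (intro sum_nonneg) (auto simp: h_def)
  have "card {H \<in> hypergraphs n k m. peel_closure p m (edge_sets k H) U = S}
      \<le> card (coverings (tuples n k) (consistent k p S) m (S - U))"
    using closure_eq_imp_covering[OF _ finS] fin by (intro card_mono) auto
  then have "real (card {H \<in> hypergraphs n k m. peel_closure p m (edge_sets k H) U = S})
      \<le> real (card (coverings (tuples n k) (consistent k p S) m (S - U)))"
    by (rule of_nat_mono)
  also have "\<dots> \<le> fact (card (S - U)) * (\<Sum>j\<le>k-p. h j * x ^ j / fact j) ^ m / x ^ card (S - U)"
    using finS bound x consistent_antimono
    by (intro card_coverings_le finite_tuples) (auto simp: h_def)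
  also have "\<dots> \<le> fact (card (S - U)) * step_bound n k p (card S) x ^ m / x ^ card (S - U)"
    using B nn x by (intro divide_right_mono mult_left_mono power_mono) auto
  finally show ?thesis .
qed

text \<open>There are at most \<open>n choose (s - u)\<close> candidates for the closure, and the
  factorial of the covering bound turns this binomial into a power of \<open>n\<close>. Each new
  vertex thus costs a factor \<open>n / x\<close>.\<close>

lemma card_closure_card_le:
  assumes x: "x > 0" and p: "p < k" and u: "u \<le> n" and nn: "0 \<le> step_bound n k p s x"
  shows "real (card {H \<in> hypergraphs n k m. card (peel_closure p m (edge_sets k H) {..<u}) = s})
          \<le> (real n / x) ^ (s - u) * step_bound n k p s x ^ m"
proof -
  define \<S> where "\<S> = {S \<in> Pow {..<n}. {..<u} \<subseteq> S \<and> card S = s}"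
  define G where "G S = {H \<in> hypergraphs n k m. peel_closure p m (edge_sets k H) {..<u} = S}" for S
  have finH: "finite (hypergraphs n k m)"
    unfolding hypergraphs_def using finite_tuples by (intro finite_PiE) auto
  have fin\<S>: "finite \<S>" by (auto simp: \<S>_def)
  have sub: "{H \<in> hypergraphs n k m. card (peel_closure p m (edge_sets k H) {..<u}) = s} \<subseteq> (\<Union>S\<in>\<S>. G S)"
  proof
    fix H assume "H \<in> {H \<in> hypergraphs n k m. card (peel_closure p m (edge_sets k H) {..<u}) = s}"
    then have H: "H \<in> hypergraphs n k m" "card (peel_closure p m (edge_sets k H) {..<u}) = s" by auto
    have "peel_closed p m (edge_sets k H) {..<n}"
      using H(1) by (auto simp: peel_closed_def edge_sets_def hypergraphs_def tuples_def PiE_iff)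
    then have "peel_closure p m (edge_sets k H) {..<u} \<subseteq> {..<n}"
      using u by (intro peel_closure_least) auto
    then have "peel_closure p m (edge_sets k H) {..<u} \<in> \<S>"
      using H(2) subset_peel_closure[of "{..<u}"] by (auto simp: \<S>_def)
    then show "H \<in> (\<Union>S\<in>\<S>. G S)" using H(1) by (auto simp: G_def)
  qed
  have card\<S>: "card \<S> \<le> n choose (s - u)"
  proof -
    have "card \<S> \<le> card {W \<in> Pow {..<n}. card W = s - u}"
    proof (rule card_inj_on_le[where f = "\<lambda>S. S - {..<u}"])
      show "inj_on (\<lambda>S. S - {..<u}) \<S>" by (rule inj_onI) (auto simp: \<S>_def)
      show "(\<lambda>S. S - {..<u}) ` \<S> \<subseteq> {W \<in> Pow {..<n}. card W = s - u}"
        by (auto simp: \<S>_def card_Diff_subset)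
    qed simp
    then show ?thesis using n_subsets[of "{..<n}" "s - u"] by simp
  qed
  have GS: "real (card (G S)) \<le> fact (s - u) * step_bound n k p s x ^ m / x ^ (s - u)" if S: "S \<in> \<S>" for S
  proof -
    have "card (S - {..<u}) = s - u" using S by (auto simp: \<S>_def card_Diff_subset)
    then show ?thesis
      using card_closure_eq_le[of S n x p k m "{..<u}"] S x p by (auto simp: G_def \<S>_def)
  qed
  have "card {H \<in> hypergraphs n k m. card (peel_closure p m (edge_sets k H) {..<u}) = s} \<le> (\<Sum>S\<in>\<S>. card (G S))"
    using sub fin\<S> finH by (intro order.trans[OF card_mono card_UN_le]) (auto simp: G_def)
  then have "real (card {H \<in> hypergraphs n k m. card (peel_closure p m (edge_sets k H) {..<u}) = s})
      \<le> (\<Sum>S\<in>\<S>. real (card (G S)))"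
    unfolding of_nat_sum[symmetric] by (rule of_nat_mono)
  also have "\<dots> \<le> (\<Sum>S\<in>\<S>. fact (s - u) * step_bound n k p s x ^ m / x ^ (s - u))"
    using GS by (rule sum_mono)
  also have "\<dots> = real (card \<S>) * fact (s - u) * (step_bound n k p s x ^ m / x ^ (s - u))"
    by simp
  also have "\<dots> \<le> real n ^ (s - u) * (step_bound n k p s x ^ m / x ^ (s - u))"
  proof (rule mult_right_mono)
    have "card \<S> * fact (s - u) \<le> n ^ (s - u)"
      using card\<S> binomial_fact_pow[of n "s - u"] by (meson mult_le_mono1 order_trans)
    then have "real (card \<S> * fact (s - u)) \<le> real (n ^ (s - u))" by (rule of_nat_mono)
    then show "real (card \<S>) * fact (s - u) \<le> real n ^ (s - u)" by simp
  qed (use x nn in auto)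
  finally show ?thesis by (simp add: power_divide)
qed

section \<open>Exponential tail above the threshold\<close>

text \<open>The subtracted product is a lower bound for the number of certain tuples, so it cannot
  exceed the number of all tuples.\<close>

lemma step_bound_nonneg:
  assumes "s \<le> n" "p < k" "0 \<le> x"
  shows "0 \<le> step_bound n k p s x"
proof -
  have "(k choose p) * ((s - k) ^ p * (n - s - k) ^ (k - p)) \<le> card (tuples n k)"
    using card_tuples_meeting_ge[of "{..<s}" n p k] assms finite_tuples[of n k]
      card_mono[of "tuples n k" "{e \<in> tuples n k. card (e ` {..<k} \<inter> {..<s}) = p}"]
    by simp
  then have "real ((k choose p) * ((s - k) ^ p * (n - s - k) ^ (k - p))) \<le> real (card (tuples n k))"
    by (rule of_nat_mono)
  moreover have "0 \<le> (\<Sum>j=1..k-p. real (k choose j) * real s ^ (k - j) * x ^ j)"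
    using assms by (intro sum_nonneg) auto
  ultimately show ?thesis by (simp add: step_bound_def)
qed

text \<open>With \<open>x = z * n\<close> and \<open>\<rho> = s / n\<close>, the loss in the
  constant term and the top degree \<open>k - p\<close> are both of order \<open>\<rho> ^ p\<close>,
  while the degrees in between carry at least one more factor \<open>\<rho>\<close>. The corrections
  by \<open>\<delta>\<close> absorb, in turn, the truncated products, the ratio of
  \<open>n ^ k\<close> to the number of tuples, and the middle degrees.\<close>

lemma step_bound_le:
  fixes \<delta> z :: real
  assumes p: "p < k" and s: "s \<le> n" "0 < n" and z: "0 < z" "z \<le> 1" and \<delta>: "0 < \<delta>" "\<delta> \<le> 1"
    and T: "real n ^ k \<le> (1 + \<delta>) * real (card (tuples n k))"
    and L: "(1 - \<delta>) * (real s ^ p * real n ^ (k - p)) \<le> real (s - k) ^ p * real (n - s - k) ^ (k - p)"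
    and small: "2 ^ (k + 1) * real s \<le> \<delta> * real n"
  shows "step_bound n k p s (z * real n) \<le> real (card (tuples n k)) *
     (1 - real (k choose p) * (real s / real n) ^ p * ((1 - \<delta>) - (1 + \<delta>) * z ^ (k - p) - \<delta>))"
proof -
  define \<rho> where "\<rho> = real s / real n"
  define T where "T = real (card (tuples n k))"
  define C where "C = real (k choose p)"
  have \<rho>: "0 \<le> \<rho>" "\<rho> \<le> 1" "2 ^ (k + 1) * \<rho> \<le> \<delta>" "real s = \<rho> * real n"
    using s small by (auto simp: \<rho>_def field_simps)
  have C1: "1 \<le> C" using p by (simp add: C_def Suc_le_eq)
  have T0: "0 \<le> T" by (simp add: T_def)
  have Tn: "T \<le> real n ^ k" using card_tuples_le[of n k] by (simp add: T_def flip: of_nat_power)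
  have npk: "real n ^ p * real n ^ (k - p) = real n ^ k" using p by (simp flip: power_add)
  have lower: "C * ((1 - \<delta>) * \<rho> ^ p * T) \<le> C * (real (s - k) ^ p * real (n - s - k) ^ (k - p))"
  proof (rule mult_left_mono)
    have "(1 - \<delta>) * \<rho> ^ p * T \<le> (1 - \<delta>) * \<rho> ^ p * real n ^ k"
      using Tn \<delta> \<rho> by (intro mult_left_mono) auto
    also have "\<dots> = (1 - \<delta>) * (real s ^ p * real n ^ (k - p))"
      by (simp add: \<rho>(4) power_mult_distrib flip: npk)
    finally show "(1 - \<delta>) * \<rho> ^ p * T \<le> real (s - k) ^ p * real (n - s - k) ^ (k - p)"
      using L by linarith
  qed (use C1 in auto)
  have summand: "real (k choose j) * real s ^ (k - j) * (z * real n) ^ j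
      = real n ^ k * (real (k choose j) * \<rho> ^ (k - j) * z ^ j)" if "j \<le> k" for j
  proof -
    have "real n ^ k = real n ^ (k - j) * real n ^ j" using that by (simp flip: power_add)
    then show ?thesis by (simp add: \<rho>(4) power_mult_distrib)
  qed
  have "(\<Sum>j=1..k-p. real (k choose j) * real s ^ (k - j) * (z * real n) ^ j)
      = real n ^ k * (\<Sum>j=1..k-p. real (k choose j) * \<rho> ^ (k - j) * z ^ j)"
    unfolding sum_distrib_left by (intro sum.cong refl summand) auto
  also have "(\<Sum>j=1..k-p. real (k choose j) * \<rho> ^ (k - j) * z ^ j)
      = C * \<rho> ^ p * z ^ (k - p) + (\<Sum>j=1..<k-p. real (k choose j) * \<rho> ^ (k - j) * z ^ j)"
  proof -
    have "{1..k-p} = insert (k - p) {1..<k-p}" using p by auto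
    moreover have "k choose (k - p) = k choose p" using p by (intro binomial_symmetric[symmetric]) simp
    ultimately show ?thesis using p by (simp add: C_def)
  qed
  also have "real n ^ k * \<dots> \<le> real n ^ k * (C * \<rho> ^ p * z ^ (k - p) + 2 ^ k * (\<rho> * \<rho> ^ p))"
  proof (intro mult_left_mono add_left_mono)
    \<comment> \<open>For \<open>j < k - p\<close> the exponent \<open>k - j\<close> is at least
      \<open>p + 1\<close>.\<close>
    have "(\<Sum>j=1..<k-p. real (k choose j) * \<rho> ^ (k - j) * z ^ j)
        \<le> (\<Sum>j=1..<k-p. real (k choose j) * \<rho> ^ (Suc p) * 1)"
    proof (rule sum_mono)
      fix j assume "j \<in> {1..<k-p}"
      then have "\<rho> ^ (k - j) \<le> \<rho> ^ (Suc p)" using \<rho> by (intro power_decreasing) auto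
      moreover have "z ^ j \<le> 1" using z by (intro power_le_one) auto
      ultimately show "real (k choose j) * \<rho> ^ (k - j) * z ^ j \<le> real (k choose j) * \<rho> ^ (Suc p) * 1"
        using z \<rho> by (intro mult_mono) auto
    qed
    also have "\<dots> = (\<Sum>j=1..<k-p. real (k choose j)) * (\<rho> * \<rho> ^ p)"
      by (simp add: sum_distrib_right)
    also have "\<dots> \<le> 2 ^ k * (\<rho> * \<rho> ^ p)"
    proof (rule mult_right_mono)
      have "(\<Sum>j=1..<k-p. real (k choose j)) \<le> (\<Sum>j\<le>k. real (k choose j))"
        by (intro sum_mono2) auto
      also have "\<dots> = 2 ^ k" using choose_row_sum[of k] by (simp flip: of_nat_sum)
      finally show "(\<Sum>j=1..<k-p. real (k choose j)) \<le> 2 ^ k" .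
    qed (use \<rho> in auto)
    finally show "(\<Sum>j=1..<k-p. real (k choose j) * \<rho> ^ (k - j) * z ^ j) \<le> 2 ^ k * (\<rho> * \<rho> ^ p)" .
  qed simp
  also have "real n ^ k * (C * \<rho> ^ p * z ^ (k - p) + 2 ^ k * (\<rho> * \<rho> ^ p))
      \<le> ((1 + \<delta>) * T) * (C * \<rho> ^ p * z ^ (k - p) + 2 ^ k * (\<rho> * \<rho> ^ p))"
    using T C1 \<rho> z by (intro mult_right_mono) (auto simp: T_def)
  also have "\<dots> = T * ((1 + \<delta>) * C * \<rho> ^ p * z ^ (k - p)) + T * ((1 + \<delta>) * 2 ^ k * \<rho> * \<rho> ^ p)"
    by (simp add: algebra_simps)
  also have "\<dots> \<le> T * ((1 + \<delta>) * C * \<rho> ^ p * z ^ (k - p)) + T * (\<delta> * C * \<rho> ^ p)"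
  proof (intro add_left_mono mult_left_mono mult_right_mono)
    have "(1 + \<delta>) * 2 ^ k * \<rho> \<le> 2 * 2 ^ k * \<rho>" using \<delta> \<rho> by (intro mult_right_mono) auto
    also have "\<dots> \<le> \<delta> * 1" using \<rho> by simp
    also have "\<dots> \<le> \<delta> * C" using C1 \<delta> by (intro mult_left_mono) auto
    finally show "(1 + \<delta>) * 2 ^ k * \<rho> \<le> \<delta> * C" .
  qed (use T0 \<rho> in auto)
  finally have upper: "(\<Sum>j=1..k-p. real (k choose j) * real s ^ (k - j) * (z * real n) ^ j)
      \<le> T * ((1 + \<delta>) * C * \<rho> ^ p * z ^ (k - p)) + T * (\<delta> * C * \<rho> ^ p)" .
  have "step_bound n k p s (z * real n) \<le> T - C * ((1 - \<delta>) * \<rho> ^ p * T) +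
      (T * ((1 + \<delta>) * C * \<rho> ^ p * z ^ (k - p)) + T * (\<delta> * C * \<rho> ^ p))"
    using lower upper by (simp add: step_bound_def T_def C_def)
  also have "\<dots> = T * (1 - C * \<rho> ^ p * ((1 - \<delta>) - (1 + \<delta>) * z ^ (k - p) - \<delta>))"
    by (simp add: algebra_simps)
  finally show ?thesis by (simp add: T_def C_def \<rho>_def)
qed

section \<open>The critical constant and the exponential bound\<close>

text \<open>For \<open>p \<ge> 2\<close> this is the maximum of
  \<open>(\<zeta> - 1) / \<zeta> ^ p\<close> over positive \<open>\<zeta>\<close>.\<close>

definition peel_const :: "nat \<Rightarrow> real" where
  "peel_const p = real (p - 1) ^ (p - 1) / real p ^ p"

lemma peel_const_pos: "2 \<le> p \<Longrightarrow> 0 < peel_const p"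
  by (simp add: peel_const_def)

text \<open>Bernoulli's inequality at \<open>\<zeta> (p - 1) / p\<close>: the power curve touches the line
  \<open>\<zeta> - 1\<close> exactly at \<open>\<zeta> = p / (p - 1)\<close>, which is where the critical constant comes from.\<close>
lemma peel_const_bound:
  fixes \<zeta> :: real
  assumes p: "2 \<le> p" and \<zeta>: "0 \<le> \<zeta>"
  shows "\<zeta> - 1 \<le> peel_const p * \<zeta> ^ p"
proof -
  define a where "a = real (p - 1)"
  have a: "a > 0" "real p = a + 1" using p by (auto simp: a_def of_nat_diff)
  have "1 + real p * (\<zeta> * a / real p - 1) \<le> (1 + (\<zeta> * a / real p - 1)) ^ p"
    using \<zeta> a by (intro Bernoulli_inequality) auto
  moreover have "1 + real p * (\<zeta> * a / real p - 1) = a * (\<zeta> - 1)"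
    using a p by (simp add: right_diff_distrib)
  ultimately have "a * (\<zeta> - 1) \<le> \<zeta> ^ p * a ^ p / real p ^ p"
    by (simp add: power_divide power_mult_distrib)
  also have "a ^ p = a * a ^ (p - 1)" using p by (simp flip: power_Suc)
  finally have "a * (\<zeta> - 1) \<le> a * (peel_const p * \<zeta> ^ p)"
    by (simp add: peel_const_def a_def field_simps)
  then show ?thesis using a by simp
qed

text \<open>The absorption identity for binomials rewrites \<open>r * (k choose r)\<close> as the
  number of ways to place \<open>r - 1\<close> of \<open>k\<close> positions times the
  \<open>k - r + 1\<close> vertices that such an edge yields.\<close>

lemma mu_crit_peel_const:
  assumes "3 \<le> r" "r \<le> k"
  shows "real (k - (r - 1)) * real (k choose (r - 1)) * mu_crit k r = peel_const (r - 1)"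
proof -
  obtain p where r: "r = Suc p" using assms by (cases r) auto
  have "Suc p * (k choose Suc p) = (k - p) * (k choose p)"
    unfolding binomial_absorb_comp binomial_absorption ..
  then have "real (Suc p) * real (k choose Suc p) = real (k - p) * real (k choose p)"
    unfolding of_nat_mult[symmetric] by (rule arg_cong)
  then have "real (k - (r - 1)) * real (k choose (r - 1)) * mu_crit k r
      = real (Suc p) * real (k choose Suc p) * mu_crit k r"
    by (simp add: r)
  also have "\<dots> = peel_const (r - 1)"
  proof -
    have "real (k choose Suc p) \<noteq> 0" "r - 2 = p - 1" using assms r by auto
    then show ?thesis by (simp add: r mu_crit_def peel_const_def)
  qed
  finally show ?thesis .
qed

text \<open>At \<open>x = exp (- \<theta>) * n\<close> each of the \<open>s - u\<close> new vertices
  costs \<open>exp \<theta>\<close>, while the \<open>m\<close> edges together gain at least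
  \<open>exp (m * y)\<close>. With \<open>\<zeta> = s / u\<close>, \<open>peel_const_bound\<close>
  compares the two, and the surplus \<open>\<gamma>\<close> in the hypothesis leaves an exponent
  linear in \<open>s\<close>.\<close>

lemma card_closure_card_exp_le:
  fixes \<delta> \<theta> \<gamma> \<mu> :: real
  assumes p: "2 \<le> p" "p < k" and s: "1 \<le> u" "u \<le> s" "s \<le> n" and \<delta>: "0 < \<delta>" "\<delta> \<le> 1"
    and \<theta>: "0 < \<theta>" and \<gamma>: "0 < \<gamma>" and \<mu>: "0 < \<mu>"
    and T0: "0 < card (tuples n k)"
    and T: "real n ^ k \<le> (1 + \<delta>) * real (card (tuples n k))"
    and L: "(1 - \<delta>) * (real s ^ p * real n ^ (k - p)) \<le> real (s - k) ^ p * real (n - s - k) ^ (k - p)"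
    and small: "2 ^ (k + 1) * real s \<le> \<delta> * real n"
    and m: "(1 - \<delta>) * (\<mu> * real n ^ p / real u ^ (p - 1)) \<le> real m"
    and \<kappa>: "\<theta> * (1 + \<gamma>) * peel_const p \<le> (1 - \<delta>) * \<mu> * real (k choose p) *
        ((1 - \<delta>) - (1 + \<delta>) * exp (- \<theta>) ^ (k - p) - \<delta>)"
  shows "real (card {H \<in> hypergraphs n k m. card (peel_closure p m (edge_sets k H) {..<u}) = s})
     / real (card (tuples n k)) ^ m \<le> exp (- (\<theta> * \<gamma> * peel_const p) * real s)"
proof -
  define C where "C = real (k choose p)"
  define \<kappa> where "\<kappa> = (1 - \<delta>) - (1 + \<delta>) * exp (- \<theta>) ^ (k - p) - \<delta>"
  define y where "y = C * (real s / real n) ^ p * \<kappa>"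
  define \<tau> where "\<tau> = real (card (tuples n k))"
  define \<zeta> where "\<zeta> = real s / real u"
  have n: "0 < n" using s by simp
  have sb0: "0 \<le> step_bound n k p s (exp (- \<theta>) * real n)"
    using s p by (intro step_bound_nonneg) auto
  have sb: "step_bound n k p s (exp (- \<theta>) * real n) \<le> \<tau> * (1 - y)"
    unfolding y_def C_def \<kappa>_def \<tau>_def using assms n by (intro step_bound_le) auto
  have \<tau>: "0 < \<tau>" using T0 by (simp add: \<tau>_def)
  \<comment> \<open>Needed before \<open>1 - y \<le> exp (- y)\<close> may be raised to the power
    \<open>m\<close>.\<close>
  then have y1: "0 \<le> 1 - y" using sb sb0 by (metis order_trans zero_le_mult_iff not_less)
  have \<zeta>: "1 \<le> \<zeta>" "real s = \<zeta> * real u" using s by (auto simp: \<zeta>_def)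
  have C0: "0 < C" using p by (simp add: C_def)
  have \<kappa>0: "0 \<le> \<kappa>"
  proof (rule ccontr)
    assume "\<not> 0 \<le> \<kappa>"
    then have "(1 - \<delta>) * \<mu> * C * \<kappa> \<le> 0"
      using \<delta> \<mu> C0 by (intro mult_nonneg_nonpos) auto
    moreover have "0 < \<theta> * (1 + \<gamma>) * peel_const p"
      using \<theta> \<gamma> peel_const_pos[OF p(1)] by simp
    ultimately show False using assms(16) by (simp add: C_def \<kappa>_def)
  qed
  have "\<theta> * (1 + \<gamma>) * peel_const p * (real u * \<zeta> ^ p) \<le> (1 - \<delta>) * \<mu> * C * \<kappa> * (real u * \<zeta> ^ p)"
    using assms(16) \<zeta> by (intro mult_right_mono) (auto simp: C_def \<kappa>_def)
  \<comment> \<open>The scaling of \<open>m\<close> matters here: \<open>n ^ p / u ^ (p - 1)\<close>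
    times \<open>(s / n) ^ p\<close> is \<open>u * \<zeta> ^ p\<close>.\<close>
  also have "\<dots> = (1 - \<delta>) * (\<mu> * real n ^ p / real u ^ (p - 1)) * y"
  proof -
    have "real u * \<zeta> ^ p = real s ^ p / real u ^ (p - 1)"
      using s p by (cases p) (auto simp: \<zeta>_def power_divide field_simps)
    moreover have "real n ^ p * y = C * real s ^ p * \<kappa>"
      using n by (simp add: y_def power_divide)
    moreover have "(1 - \<delta>) * (\<mu> * real n ^ p / real u ^ (p - 1)) * y
        = (1 - \<delta>) * \<mu> * (real n ^ p * y) / real u ^ (p - 1)" by simp
    ultimately show ?thesis by (simp add: mult_ac)
  qed
  also have "\<dots> \<le> real m * y"
    using m C0 \<kappa>0 by (intro mult_right_mono) (auto simp: y_def)
  finally have my: "\<theta> * (1 + \<gamma>) * peel_const p * (real u * \<zeta> ^ p) \<le> real m * y" .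
  have "\<theta> * (real s - real u) = \<theta> * real u * (\<zeta> - 1)" by (simp add: \<zeta> algebra_simps)
  also have "\<dots> \<le> \<theta> * real u * (peel_const p * \<zeta> ^ p)"
    using peel_const_bound[OF p(1), of \<zeta>] \<zeta> \<theta> by (intro mult_left_mono) auto
  finally have w: "\<theta> * (real s - real u) \<le> \<theta> * real u * (peel_const p * \<zeta> ^ p)" .
  have "\<theta> * \<gamma> * peel_const p * real s \<le> \<theta> * \<gamma> * peel_const p * (real u * \<zeta> ^ p)"
  proof (rule mult_left_mono)
    have "\<zeta> ^ 1 \<le> \<zeta> ^ p" using \<zeta> p by (intro power_increasing) auto
    then have "real u * \<zeta> \<le> real u * \<zeta> ^ p" by (intro mult_left_mono) auto
    then show "real s \<le> real u * \<zeta> ^ p" by (simp add: \<zeta>(2) mult.commute)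
  qed (use \<theta> \<gamma> peel_const_pos[OF p(1)] in auto)
  then have expo: "\<theta> * (real s - real u) - real m * y \<le> - (\<theta> * \<gamma> * peel_const p) * real s"
    using my w by (simp add: algebra_simps)
  have "real (card {H \<in> hypergraphs n k m. card (peel_closure p m (edge_sets k H) {..<u}) = s})
      \<le> (real n / (exp (- \<theta>) * real n)) ^ (s - u) * step_bound n k p s (exp (- \<theta>) * real n) ^ m"
    using s p n sb0 by (intro card_closure_card_le) auto
  also have "real n / (exp (- \<theta>) * real n) = exp \<theta>"
    using n by (simp add: exp_minus field_simps)
  also have "exp \<theta> ^ (s - u) = exp (\<theta> * (real s - real u))"
    using s by (simp add: of_nat_diff mult.commute flip: exp_of_nat_mult)
  also have "exp (\<theta> * (real s - real u)) * step_bound n k p s (exp (- \<theta>) * real n) ^ m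
      \<le> exp (\<theta> * (real s - real u)) * (\<tau> ^ m * exp (- (real m * y)))"
  proof (rule mult_left_mono)
    have "step_bound n k p s (exp (- \<theta>) * real n) ^ m \<le> (\<tau> * (1 - y)) ^ m"
      using sb sb0 by (rule power_mono)
    also have "\<dots> \<le> \<tau> ^ m * exp (- (real m * y))"
    proof -
      have "(1 - y) ^ m \<le> exp (- y) ^ m"
        using y1 exp_ge_add_one_self[of "- y"] by (intro power_mono) auto
      then show ?thesis using \<tau> by (simp add: power_mult_distrib flip: exp_of_nat_mult)
    qed
    finally show "step_bound n k p s (exp (- \<theta>) * real n) ^ m \<le> \<tau> ^ m * exp (- (real m * y))" .
  qed simp
  also have "exp (\<theta> * (real s - real u)) * (\<tau> ^ m * exp (- (real m * y)))
      = \<tau> ^ m * exp (\<theta> * (real s - real u) - real m * y)"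
    by (simp add: exp_diff exp_minus divide_simps)
  also have "\<dots> \<le> \<tau> ^ m * exp (- (\<theta> * \<gamma> * peel_const p) * real s)"
    using expo \<tau> by simp
  finally show ?thesis using \<tau> by (simp add: \<tau>_def field_simps)
qed

section \<open>Tail sums and the success probability\<close>

lemma sum_exp_tail_le:
  fixes c :: real
  assumes "0 < c"
  shows "(\<Sum>s=a..<b. exp (- c * real s)) \<le> exp (- c * real a) / (1 - exp (- c))"
proof (cases "a \<le> b")
  case True
  have e: "exp (- c) < 1" using assms by simp
  have pow: "exp (- c * real s) = exp (- c) ^ s" for s
    by (simp add: mult.commute flip: exp_of_nat_mult)
  have "(\<Sum>s=a..<b. exp (- c) ^ s) * (1 - exp (- c)) = exp (- c) ^ a - exp (- c) ^ b"
    using True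
  proof (induction b rule: dec_induct)
    case (step b)
    then have "(\<Sum>s=a..<Suc b. exp (- c) ^ s) * (1 - exp (- c))
        = (exp (- c) ^ a - exp (- c) ^ b) + exp (- c) ^ b * (1 - exp (- c))"
      by (simp only: sum.atLeastLessThan_Suc distrib_right)
    then show ?case by (simp add: right_diff_distrib)
  qed simp
  then have "(\<Sum>s=a..<b. exp (- c * real s)) = (exp (- c) ^ a - exp (- c) ^ b) / (1 - exp (- c))"
    unfolding pow using e by (simp add: field_simps)
  also have "\<dots> \<le> exp (- c) ^ a / (1 - exp (- c))"
    using e by (intro divide_right_mono) auto
  finally show ?thesis by (simp add: mult.commute flip: exp_of_nat_mult)
next
  case False
  then show ?thesis using assms by simp
qed

lemma card_hypergraphs: "card (hypergraphs n k m) = card (tuples n k) ^ m"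
  by (simp add: hypergraphs_def card_PiE)

text \<open>The closure depends on the hypergraph alone, so a hypergraph with large closure is good
  for every planted input and the factor \<open>card (cube q n)\<close> cancels.\<close>

lemma prob_good_ge:
  assumes "uu \<le> n" "0 < q" "1 \<le> r" "r \<le> k" and T0: "0 < card (tuples n k)"
    and mds: "\<And>a. a < m \<Longrightarrow> mds_inverse_image q k r (f a)"
  shows "1 - real (card {H \<in> hypergraphs n k m.
             real (card (peel_closure (r - 1) m (edge_sets k H) {..<uu})) < \<beta> * real n})
           / real (card (tuples n k)) ^ m \<le> prob_good q k r n m uu f \<beta>"
proof -
  let ?c = "\<lambda>H. real (card (peel_closure (r - 1) m (edge_sets k H) {..<uu}))"
  let ?Hs = "hypergraphs n k m"
  let ?bad = "{H \<in> ?Hs. ?c H < \<beta> * real n}"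
  let ?G = "{(t, xs) \<in> ?Hs \<times> cube q n. \<forall>bi ba. zero_optimal q k r n m uu f t xs bi ba \<longrightarrow>
                       \<beta> * real n \<le> real (card (integral_part q n bi))}"
  have finH: "finite ?Hs"
    unfolding hypergraphs_def using finite_tuples by (intro finite_PiE) auto
  have Q: "0 < card (cube q n)" using assms(2) by (simp add: cube_def card_PiE)
  have H: "0 < card ?Hs" using T0 by (simp add: card_hypergraphs)
  have good: "\<beta> * real n \<le> real (card (integral_part q n bi))"
    if t: "t \<in> ?Hs" and nb: "\<not> ?c t < \<beta> * real n"
      and xs: "xs \<in> cube q n" and zo: "zero_optimal q k r n m uu f t xs bi ba" for t xs bi ba
  proof -
    have "card (peel_closure (r - 1) m (\<lambda>a. t a ` {..<k}) {..<uu}) \<le> card (integral_part q n bi)"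
      by (rule integral_part_ge_closure[OF zo]) (use t xs assms mds in auto)
    then have "?c t \<le> real (card (integral_part q n bi))"
      by (simp add: edge_sets_def[abs_def])
    then show ?thesis using nb by linarith
  qed
  have sub: "(?Hs - ?bad) \<times> cube q n \<subseteq> ?G"
    using good by auto
  have "card ((?Hs - ?bad) \<times> cube q n) \<le> card ?G"
    using sub finH finite_cube by (intro card_mono finite_subset[of ?G "?Hs \<times> cube q n"]) auto
  moreover have "card (?Hs - ?bad) = card ?Hs - card ?bad"
    using finH by (intro card_Diff_subset) auto
  moreover have "card ?bad \<le> card ?Hs" using finH by (intro card_mono) auto
  moreover have "(real h - real b) * real c \<le> real g" if "a * c \<le> g" "a = h - b" "b \<le> h"
    for a b c g h :: nat
    using that by (metis of_nat_diff of_nat_mult of_nat_le_iff)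
  ultimately have "(real (card ?Hs) - real (card ?bad)) * real (card (cube q n)) \<le> real (card ?G)"
    unfolding card_cartesian_product by blast
  then have "(real (card ?Hs) - real (card ?bad)) * real (card (cube q n))
      / (real (card ?Hs) * real (card (cube q n))) \<le> prob_good q k r n m uu f \<beta>"
    unfolding prob_good_def card_cartesian_product of_nat_mult using Q H
    by (intro divide_right_mono) auto
  then show ?thesis using Q T0 by (simp add: card_hypergraphs diff_divide_distrib)
qed

section \<open>Choice of constants and estimates for large \<open>n\<close>\<close>

text \<open>At \<open>\<delta> = 0\<close> and to first order in \<open>\<theta>\<close> the
  inequality reads \<open>(1 + \<gamma>) * c \<le> d * A\<close>, which the strict hypothesis
  permits. Explicit \<open>\<theta>\<close> and \<open>\<gamma>\<close> make it strict at
  \<open>\<delta> = 0\<close>, and continuity then supplies a positive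
  \<open>\<delta>\<close>.\<close>

lemma peel_constants_exist:
  fixes A c :: real
  assumes c: "0 < c" and A: "c < real d * A"
  shows "\<exists>\<theta>>0. \<exists>\<gamma>>0. \<exists>\<delta>>0. \<delta> \<le> 1 \<and>
    \<theta> * (1 + \<gamma>) * c \<le> (1 - \<delta>) * A * ((1 - \<delta>) - (1 + \<delta>) * exp (- \<theta>) ^ d - \<delta>)"
proof -
  have d: "0 < d" using c A by (cases d) auto
  define R where "R = real d * A / c"
  have R: "1 < R" using c A by (simp add: R_def)
  \<comment> \<open>These choices give \<open>1 + 2 * \<gamma> = R / (1 + x)\<close>. Only half of
    the gain \<open>2 * \<gamma>\<close> is claimed; the other half is the slack for
    \<open>\<delta>\<close>.\<close>
  define x where "x = (R - 1) / 2"
  define \<theta> where "\<theta> = x / real d"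
  define \<gamma> where "\<gamma> = (R - 1) / (2 * (R + 1))"
  have pos: "0 < x" "0 < \<theta>" "0 < \<gamma>" using R d by (auto simp: x_def \<theta>_def \<gamma>_def)
  have A0: "A = R * c / real d" using c d by (simp add: R_def)
  have Apos: "0 < A" unfolding A0 using R c d by simp
  have "exp (- \<theta>) ^ d = exp (- x)"
    using d by (simp add: \<theta>_def flip: exp_of_nat_mult)
  then have "exp (- \<theta>) ^ d \<le> 1 / (1 + x)"
    using pos exp_ge_add_one_self[of x] by (simp add: exp_minus field_simps)
  then have "A * (x / (1 + x)) \<le> A * (1 - exp (- \<theta>) ^ d)"
    using Apos pos by (intro mult_left_mono) (auto simp: field_simps)
  moreover have "A * (x / (1 + x)) = \<theta> * (1 + 2 * \<gamma>) * c"
  proof -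
    have "1 + 2 * \<gamma> = R / (1 + x)" using R by (simp add: \<gamma>_def x_def field_simps)
    then show ?thesis by (simp add: A0 \<theta>_def)
  qed
  moreover have "\<theta> * (1 + \<gamma>) * c < \<theta> * (1 + 2 * \<gamma>) * c" using pos c by simp
  ultimately have less: "\<theta> * (1 + \<gamma>) * c < A * (1 - exp (- \<theta>) ^ d)" by linarith
  have "((\<lambda>\<delta>. (1 - \<delta>) * A * ((1 - \<delta>) - (1 + \<delta>) * exp (- \<theta>) ^ d - \<delta>)) \<longlongrightarrow>
      (1 - 0) * A * ((1 - 0) - (1 + 0) * exp (- \<theta>) ^ d - 0)) (at_right 0)"
    by (intro tendsto_intros)
  then have "\<forall>\<^sub>F \<delta> in at_right 0.
      \<theta> * (1 + \<gamma>) * c < (1 - \<delta>) * A * ((1 - \<delta>) - (1 + \<delta>) * exp (- \<theta>) ^ d - \<delta>)"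
    using less by (intro order_tendstoD(1)) auto
  moreover have "\<forall>\<^sub>F \<delta>::real in at_right 0. \<delta> \<in> {0<..<1}"
    by (rule eventually_at_right_real) simp
  ultimately have "\<forall>\<^sub>F \<delta> in at_right 0. 0 < \<delta> \<and> \<delta> \<le> 1 \<and>
      \<theta> * (1 + \<gamma>) * c \<le> (1 - \<delta>) * A * ((1 - \<delta>) - (1 + \<delta>) * exp (- \<theta>) ^ d - \<delta>)"
    by eventually_elim auto
  then obtain \<delta> where "0 < \<delta> \<and> \<delta> \<le> 1 \<and>
      \<theta> * (1 + \<gamma>) * c \<le> (1 - \<delta>) * A * ((1 - \<delta>) - (1 + \<delta>) * exp (- \<theta>) ^ d - \<delta>)"
    using eventually_happens[of _ "at_right (0::real)"] by auto
  then show ?thesis using pos by blast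
qed

text \<open>Each of the \<open>k\<close> factors loses at most the proportion
  \<open>\<eta> = \<delta> / k\<close>, and Bernoulli's inequality bounds the total loss by
  \<open>\<delta>\<close>.\<close>

lemma falling_product_ge:
  fixes \<delta> :: real
  assumes k: "0 < k" "p \<le> k" and \<delta>: "0 < \<delta>" "\<delta> \<le> 1"
    and s: "real (k * k) \<le> \<delta> * real s" "2 * real k * real s \<le> \<delta> * real n"
    and n: "2 * real (k * k) \<le> \<delta> * real n"
  shows "(1 - \<delta>) * (real s ^ p * real n ^ (k - p)) \<le> real (s - k) ^ p * real (n - s - k) ^ (k - p)"
proof -
  define \<eta> where "\<eta> = \<delta> / real k"
  have \<eta>: "0 \<le> \<eta>" "\<eta> \<le> 1" "\<eta> * real k = \<delta>" using k \<delta> by (auto simp: \<eta>_def field_simps)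
  have 1: "real s * (1 - \<eta>) \<le> real (s - k)"
  proof -
    have "real k * real k \<le> real k * (\<eta> * real s)" using s(1) by (simp add: mult_ac flip: \<eta>(3))
    then have "real k \<le> \<eta> * real s" using k by simp
    then show ?thesis by (simp add: algebra_simps)
  qed
  have 2: "real n * (1 - \<eta>) \<le> real (n - s - k)"
  proof -
    have "real k * (2 * real s) \<le> real k * (\<eta> * real n)" using s(2) by (simp add: mult_ac flip: \<eta>(3))
    moreover have "real k * (2 * real k) \<le> real k * (\<eta> * real n)" using n by (simp add: mult_ac flip: \<eta>(3))
    ultimately have "2 * real s \<le> \<eta> * real n" "2 * real k \<le> \<eta> * real n" using k by simp_all
    then show ?thesis by (simp add: algebra_simps)
  qed
  have "1 + real k * (- \<eta>) \<le> (1 + (- \<eta>)) ^ k"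
    using \<eta> by (intro Bernoulli_inequality) auto
  then have "1 - \<delta> \<le> (1 - \<eta>) ^ k" using \<eta>(3) by (simp add: mult.commute)
  then have "(1 - \<delta>) * (real s ^ p * real n ^ (k - p)) \<le> (1 - \<eta>) ^ k * (real s ^ p * real n ^ (k - p))"
    by (intro mult_right_mono) auto
  also have "\<dots> = (real s * (1 - \<eta>)) ^ p * (real n * (1 - \<eta>)) ^ (k - p)"
  proof -
    have "(1 - \<eta>) ^ k = (1 - \<eta>) ^ p * (1 - \<eta>) ^ (k - p)" using k by (simp flip: power_add)
    then show ?thesis by (simp add: power_mult_distrib)
  qed
  also have "\<dots> \<le> real (s - k) ^ p * real (n - s - k) ^ (k - p)"
    using 1 2 \<eta> by (intro mult_mono power_mono) auto
  finally show ?thesis .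
qed

lemma eventually_card_tuples_ge:
  fixes \<delta> :: real
  assumes "0 < \<delta>"
  shows "\<forall>\<^sub>F n in sequentially. real n ^ k \<le> (1 + \<delta>) * real (card (tuples n k))"
proof -
  have "(\<lambda>n. (1 - real k / real n) ^ k) \<longlonglongrightarrow> (1 - 0) ^ k"
    by (intro tendsto_intros lim_const_over_n)
  then have "\<forall>\<^sub>F n in sequentially. 1 / (1 + \<delta>) < (1 - real k / real n) ^ k"
    using assms by (intro order_tendstoD(1)) auto
  then show ?thesis using eventually_gt_at_top[of k]
  proof eventually_elim
    case (elim n)
    have "real n ^ k * (1 / (1 + \<delta>)) \<le> real n ^ k * (1 - real k / real n) ^ k"
      using elim(1) by (intro mult_left_mono) auto
    also have "\<dots> = (real n * (1 - real k / real n)) ^ k" by (simp add: power_mult_distrib)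
    also have "real n * (1 - real k / real n) = real (n - k)"
      using elim(2) by (simp add: right_diff_distrib of_nat_diff)
    also have "real (n - k) ^ k \<le> real (card (tuples n k))"
      using card_tuples_ge[of n k] by (simp flip: of_nat_power)
    finally show ?case using assms by (simp add: field_simps)
  qed
qed

text \<open>Rounding down loses at most 1, and this is at most a fraction \<open>\<delta>\<close>
  because \<open>u \<le> n\<close> makes the unrounded value at least
  \<open>\<mu> * n\<close>.\<close>

lemma num_constraints_ge:
  fixes \<delta> \<mu> :: real
  assumes r: "3 \<le> r" and u: "1 \<le> u" "u \<le> n" and \<mu>: "0 < \<mu>" and \<delta>: "0 < \<delta>" "1 \<le> \<delta> * \<mu> * real n"
  shows "(1 - \<delta>) * (\<mu> * real n ^ (r - 1) / real u ^ (r - 2)) \<le> real (num_constraints \<mu> r u n)"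
proof -
  define Y where "Y = \<mu> * real n ^ (r - 1) / real u ^ (r - 2)"
  have "real n * real u ^ (r - 2) \<le> real n * real n ^ (r - 2)"
    using u by (intro mult_left_mono power_mono) auto
  also have "\<dots> = real n ^ (r - 1)"
  proof -
    have "r - 1 = Suc (r - 2)" using r by simp
    then show ?thesis by simp
  qed
  finally have "real n \<le> real n ^ (r - 1) / real u ^ (r - 2)"
    using u by (simp add: field_simps)
  then have "\<delta> * \<mu> * real n \<le> \<delta> * \<mu> * (real n ^ (r - 1) / real u ^ (r - 2))"
    using \<delta> \<mu> by (intro mult_left_mono) auto
  then have "1 \<le> \<delta> * Y" using \<delta>(2) by (simp add: Y_def)
  moreover have "Y - 1 \<le> real (nat \<lfloor>Y\<rfloor>)" by linarith
  moreover have "(1 - \<delta>) * Y = Y - \<delta> * Y" by (simp add: left_diff_distrib)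
  ultimately have "(1 - \<delta>) * Y \<le> real (nat \<lfloor>Y\<rfloor>)" by linarith
  then show ?thesis by (simp only: num_constraints_def Y_def)
qed

text \<open>The closure contains the \<open>u\<close> seeds, so the union bound over its size starts
  at \<open>u\<close> and is a geometric sum dominated by its first term.\<close>

lemma card_small_closure_le:
  fixes b :: nat and c :: real
  assumes c: "0 < c"
    and le: "\<And>s. u \<le> s \<Longrightarrow> s < b \<Longrightarrow>
      real (card {H \<in> hypergraphs n k m. card (peel_closure p m (edge_sets k H) {..<u}) = s}) / \<tau>
        \<le> exp (- c * real s)"
    and \<tau>: "0 < \<tau>" and u: "u \<le> n"
  shows "real (card {H \<in> hypergraphs n k m. card (peel_closure p m (edge_sets k H) {..<u}) < b}) / \<tau>
      \<le> exp (- c * real u) / (1 - exp (- c))"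
proof -
  let ?cl = "\<lambda>H. peel_closure p m (edge_sets k H) {..<u}"
  have finH: "finite (hypergraphs n k m)"
    unfolding hypergraphs_def using finite_tuples by (intro finite_PiE) auto
  have ge: "u \<le> card (?cl H)" if "H \<in> hypergraphs n k m" for H
  proof -
    have "peel_closed p m (edge_sets k H) {..<n}"
      using that by (auto simp: peel_closed_def edge_sets_def hypergraphs_def tuples_def PiE_iff)
    then have "?cl H \<subseteq> {..<n}"
      using u by (intro peel_closure_least) auto
    then have "card {..<u} \<le> card (?cl H)"
      by (intro card_mono subset_peel_closure) (rule finite_subset, auto)
    then show ?thesis by simp
  qed
  have "{H \<in> hypergraphs n k m. card (?cl H) < b}
      \<subseteq> (\<Union>s\<in>{u..<b}. {H \<in> hypergraphs n k m. card (?cl H) = s})"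
    using ge by auto
  then have "card {H \<in> hypergraphs n k m. card (?cl H) < b}
      \<le> (\<Sum>s=u..<b. card {H \<in> hypergraphs n k m. card (?cl H) = s})"
    using finH by (intro order.trans[OF card_mono card_UN_le]) auto
  then have "real (card {H \<in> hypergraphs n k m. card (?cl H) < b})
      \<le> (\<Sum>s=u..<b. real (card {H \<in> hypergraphs n k m. card (?cl H) = s}))"
    unfolding of_nat_sum[symmetric] by (rule of_nat_mono)
  then have "real (card {H \<in> hypergraphs n k m. card (?cl H) < b}) / \<tau>
      \<le> (\<Sum>s=u..<b. real (card {H \<in> hypergraphs n k m. card (?cl H) = s})) / \<tau>"
    using \<tau> by (intro divide_right_mono) auto
  also have "\<dots> = (\<Sum>s=u..<b. real (card {H \<in> hypergraphs n k m. card (?cl H) = s}) / \<tau>)"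
    by (rule sum_divide_distrib)
  also have "\<dots> \<le> (\<Sum>s=u..<b. exp (- c * real s))"
    using le by (intro sum_mono) auto
  also have "\<dots> \<le> exp (- c * real u) / (1 - exp (- c))"
    using c by (rule sum_exp_tail_le)
  finally show ?thesis .
qed

section \<open>Assembling the estimates\<close>

theorem theorem2:
  fixes q k r :: nat and u :: "nat \<Rightarrow> nat" and \<mu> :: real
    and f :: "nat \<Rightarrow> nat \<Rightarrow> (nat \<Rightarrow> nat) \<Rightarrow> (nat \<Rightarrow> nat)"
  assumes "q \<ge> 2" and "k \<ge> 3" and "3 \<le> r" and "r \<le> k"
    and "filterlim u at_top sequentially"
    and "(\<lambda>n. real (u n) / real n) \<longlonglongrightarrow> 0"
    and "\<And>n a. a < num_constraints \<mu> r (u n) n \<Longrightarrow> mds_inverse_image q k r (f n a)"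
    and "\<mu> > mu_crit k r"
  shows "\<exists>c>0. \<exists>\<beta>>0. \<forall>\<^sub>F n in sequentially.
           prob_good q k r n (num_constraints \<mu> r (u n) n) (u n) (f n) \<beta>
             \<ge> 1 - exp (- c * real (u n))"
proof -
  define p where "p = r - 1"
  have p: "2 \<le> p" "p < k" "r - 1 = p" "r - 2 = p - 1" using assms(3,4) by (auto simp: p_def)
  have k0: "0 < k" using assms(2) by simp
  have mc: "real (k - p) * real (k choose p) * mu_crit k r = peel_const p"
    using mu_crit_peel_const[OF assms(3,4)] unfolding p(3) .
  have C0: "0 < real (k - p) * real (k choose p)" using p by simp
  then have "0 < mu_crit k r" using peel_const_pos[OF p(1)] mc by (metis zero_less_mult_pos)
  then have \<mu>: "0 < \<mu>" using assms(8) by simp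
  have "peel_const p < real (k - p) * (\<mu> * real (k choose p))"
    using mult_strict_left_mono[OF assms(8) C0] unfolding mc by (simp only: mult_ac)
  from peel_constants_exist[OF peel_const_pos[OF p(1)] this]
  obtain \<theta> \<gamma> \<delta> where \<theta>: "0 < \<theta>" and \<gamma>: "0 < \<gamma>" and \<delta>: "0 < \<delta>" "\<delta> \<le> 1"
    and \<kappa>: "\<theta> * (1 + \<gamma>) * peel_const p \<le> (1 - \<delta>) * (\<mu> * real (k choose p)) *
        ((1 - \<delta>) - (1 + \<delta>) * exp (- \<theta>) ^ (k - p) - \<delta>)"
    by blast
  \<comment> \<open>Small enough that \<open>s \<le> \<beta> * n\<close> yields both smallness
    conditions on \<open>s\<close>: the one with \<open>2 ^ (k + 1)\<close> for the middle degrees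
    and the one with \<open>2 * k\<close> for the truncated products.\<close>
  define \<beta> where "\<beta> = \<delta> / (2 ^ (k + 1) * real k)"
  define c where "c = \<theta> * \<gamma> * peel_const p"
  have c: "0 < c" using \<theta> \<gamma> peel_const_pos[OF p(1)] by (simp add: c_def)
  then have e1: "0 < 1 - exp (- c)" by simp
  have \<beta>: "0 < \<beta>" using \<delta> k0 by (simp add: \<beta>_def)
  have \<beta>1: "2 ^ (k + 1) * \<beta> \<le> \<delta>" "2 * real k * \<beta> \<le> \<delta>"
  proof -
    have "2 ^ (k + 1) * \<beta> = \<delta> / real k" by (simp add: \<beta>_def)
    also have "\<dots> \<le> \<delta> / 1" using \<delta> k0 by (intro divide_left_mono) auto
    finally show "2 ^ (k + 1) * \<beta> \<le> \<delta>" by simp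
    have "2 * real k * \<beta> = \<delta> / 2 ^ k" using k0 by (simp add: \<beta>_def)
    also have "\<dots> \<le> \<delta> / 1" using \<delta> by (intro divide_left_mono) auto
    finally show "2 * real k * \<beta> \<le> \<delta>" by simp
  qed
  have large_n: "\<forall>\<^sub>F n in sequentially. K \<le> real n" for K
    using eventually_ge_at_top[of "nat \<lceil>K\<rceil>"] by eventually_elim linarith
  have large_u: "\<forall>\<^sub>F n in sequentially. K \<le> real (u n)" for K
    using filterlim_compose[OF filterlim_real_sequentially assms(5)]
    by (simp add: filterlim_at_top)
  have "\<forall>\<^sub>F n in sequentially. real (u n) / real n < 1"
    using assms(6) by (rule order_tendstoD) simp
  \<comment> \<open>Half of the rate \<open>c\<close> is given up to absorb the constant factor
    \<open>1 / (1 - exp (- c))\<close> of the geometric sum.\<close>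
  then have "\<forall>\<^sub>F n in sequentially. 1 - exp (- (c / 2) * real (u n))
      \<le> prob_good q k r n (num_constraints \<mu> r (u n) n) (u n) (f n) \<beta>"
    using eventually_card_tuples_ge[OF \<delta>(1), of k] large_n[of 1] large_n[of "2 * real (k * k) / \<delta>"]
      large_n[of "1 / (\<delta> * \<mu>)"] large_u[of 1] large_u[of "real (k * k) / \<delta>"]
      large_u[of "- ln (1 - exp (- c)) / (c / 2)"]
  proof eventually_elim
    case (elim n)
    let ?m = "num_constraints \<mu> r (u n) n"
    have n0: "0 < n" using elim(3) by simp
    have un: "1 \<le> u n" "u n \<le> n" using elim(1,6) n0 by (auto simp: field_simps)
    have T0: "0 < card (tuples n k)"
    proof (rule ccontr)
      assume "\<not> 0 < card (tuples n k)"
      then have "real n ^ k \<le> 0" using elim(2) by simp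
      moreover have "0 < real n ^ k" using n0 by simp
      ultimately show False by linarith
    qed
    have m: "(1 - \<delta>) * (\<mu> * real n ^ p / real (u n) ^ (p - 1)) \<le> real ?m"
      using num_constraints_ge[OF assms(3) un \<mu> \<delta>(1)] elim(5) \<delta> \<mu> p by (simp add: field_simps)
    \<comment> \<open>Rounding up makes \<open>s < ?b\<close> equivalent to
      \<open>s < \<beta> * n\<close> for natural \<open>s\<close>.\<close>
    let ?b = "nat \<lceil>\<beta> * real n\<rceil>"
    have "real (card {H \<in> hypergraphs n k ?m. card (peel_closure p ?m (edge_sets k H) {..<u n}) < ?b})
        / real (card (tuples n k)) ^ ?m \<le> exp (- c * real (u n)) / (1 - exp (- c))"
    proof (rule card_small_closure_le)
      fix s assume s: "u n \<le> s" "s < ?b"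
      have sb: "real s \<le> \<beta> * real n" using s(2) by linarith
      have s1: "2 ^ (k + 1) * real s \<le> \<delta> * real n"
      proof -
        have "2 ^ (k + 1) * real s \<le> 2 ^ (k + 1) * (\<beta> * real n)" using sb by (rule mult_left_mono) simp
        also have "\<dots> \<le> \<delta> * real n"
          using mult_right_mono[OF \<beta>1(1), of "real n"] by (simp add: mult_ac)
        finally show ?thesis .
      qed
      have s2: "2 * real k * real s \<le> \<delta> * real n"
      proof -
        have "2 * real k * real s \<le> 2 * real k * (\<beta> * real n)" using sb by (rule mult_left_mono) simp
        also have "\<dots> \<le> \<delta> * real n"
          using mult_right_mono[OF \<beta>1(2), of "real n"] by (simp add: mult_ac)
        finally show ?thesis .
      qed
      have s3: "s \<le> n"
      proof -
        have "1 * real s \<le> 2 ^ (k + 1) * real s" by (intro mult_right_mono one_le_power) auto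
        also have "\<dots> \<le> 1 * real n" using s1 \<delta> by (elim order_trans) (rule mult_right_mono, auto)
        finally show ?thesis by simp
      qed
      \<comment> \<open>Closures have at least \<open>u n\<close> vertices, and \<open>u n\<close>
        tends to infinity, so removing \<open>k\<close> vertices from \<open>s\<close> is a
        negligible change.\<close>
      have s4: "real (k * k) \<le> \<delta> * real s"
      proof -
        have "real (k * k) / \<delta> \<le> real s" using elim(7) s(1) by linarith
        then show ?thesis using \<delta> by (simp add: field_simps)
      qed
      have n1: "2 * real (k * k) \<le> \<delta> * real n" using elim(4) \<delta> by (simp add: field_simps)
      have L: "(1 - \<delta>) * (real s ^ p * real n ^ (k - p)) \<le> real (s - k) ^ p * real (n - s - k) ^ (k - p)"
        using falling_product_ge[OF k0 _ \<delta> s4 s2 n1, of p] p by simp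
      show "real (card {H \<in> hypergraphs n k ?m. card (peel_closure p ?m (edge_sets k H) {..<u n}) = s})
          / real (card (tuples n k)) ^ ?m \<le> exp (- c * real s)"
        unfolding c_def
        by (rule card_closure_card_exp_le[OF p(1,2) un(1) s(1) s3 \<delta> \<theta> \<gamma> \<mu> T0 elim(2) L s1 m])
          (use \<kappa> in \<open>simp add: mult.assoc\<close>)
    qed (use c T0 un in auto)
    also have "exp (- c * real (u n)) / (1 - exp (- c)) \<le> exp (- (c / 2) * real (u n))"
    proof -
      \<comment> \<open>For large \<open>u n\<close> one of the two equal factors of
        \<open>exp (- c * u n)\<close> is at most \<open>1 - exp (- c)\<close> and cancels the
        denominator.\<close>
      have "- ln (1 - exp (- c)) \<le> c / 2 * real (u n)"
        using elim(8) c by (simp add: field_simps)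
      then have "exp (- (c / 2) * real (u n)) \<le> exp (ln (1 - exp (- c)))"
        by (simp only: exp_le_cancel_iff)
      then have "exp (- (c / 2) * real (u n)) * exp (- (c / 2) * real (u n))
          \<le> exp (- (c / 2) * real (u n)) * (1 - exp (- c))"
        unfolding exp_ln[OF e1] by (rule mult_left_mono) simp
      moreover have "exp (- (c / 2) * real (u n)) * exp (- (c / 2) * real (u n)) = exp (- c * real (u n))"
        by (simp flip: exp_add)
      ultimately show ?thesis using e1 by (simp add: field_simps)
    qed
    finally have bad: "real (card {H \<in> hypergraphs n k ?m.
          card (peel_closure p ?m (edge_sets k H) {..<u n}) < ?b})
        / real (card (tuples n k)) ^ ?m \<le> exp (- (c / 2) * real (u n))" .
    have "(card (peel_closure p ?m (edge_sets k H) {..<u n}) < ?b) \<longleftrightarrow>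
        real (card (peel_closure (r - 1) ?m (edge_sets k H) {..<u n})) < \<beta> * real n" for H
      unfolding p(3) by linarith
    then have "1 - real (card {H \<in> hypergraphs n k ?m.
          card (peel_closure p ?m (edge_sets k H) {..<u n}) < ?b})
        / real (card (tuples n k)) ^ ?m \<le> prob_good q k r n ?m (u n) (f n) \<beta>"
      using prob_good_ge[of "u n" n q r k ?m "f n" \<beta>] assms(1,3,4,7) un T0 by simp
    then show ?case using bad by linarith
  qed
  then show ?thesis using c \<beta> by (intro exI[of _ "c / 2"] exI[of _ \<beta>] conjI) auto
qed

end
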